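(* For every $n\ge 1$, if the edges of the complete graph $K_n$ are $2$-locally coloured, then the vertex set of $K_n$ can be partitioned into two vertex-disjoint monochromatic cycles of different colours.
   Context: An edge colouring of a graph is a $2$-local colouring if the edges incident to any vertex are coloured with at most $2$ colours; the total number of colours used is not restricted. A cycle is monochromatic if all its edges have the same colour. By convention, a single vertex, a single edge, and the empty set are also considered to be cycles (of any colour). *)

theory Defs
  imports Main
begin

text \<open>The complete graph K_n on a finite vertex set V with card V = n; an edge colouring
  assigns a colour (a natural number; the number of colours is unrestricted) to every
  two-element set {v,w}, v \<noteq> w (values on other sets are irrelevant).\<close>

definition two_local :: "'a set \<Rightarrow> ('a set \<Rightarrow> nat) \<Rightarrow> bool" where
  "two_local V c \<longleftrightarrow> (\<forall>v\<in>V. card ((\<lambda>w. c {v, w}) ` (V - {v})) \<le> 2)"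

text \<open>S is the vertex set of a monochromatic cycle of colour a in the complete graph:
  by convention the empty set, a single vertex and a single edge are cycles of any colour;
  otherwise S is traversed by a cyclic sequence of at least 3 distinct vertices whose
  consecutive edges (including last-to-first) all have colour a.\<close>

definition mono_cycle :: "('a set \<Rightarrow> nat) \<Rightarrow> nat \<Rightarrow> 'a set \<Rightarrow> bool" where
  "mono_cycle c a S \<longleftrightarrow>
     (finite S \<and> card S \<le> 2) \<or>
     (\<exists>vs. distinct vs \<and> 3 \<le> length vs \<and> set vs = S \<and>
        (\<forall>i<length vs. c {vs ! i, vs ! ((i + 1) mod length vs)} = a))"

end

theory Submission
  imports Defs
begin

text \<open>
  If all vertices see a common colour \<open>g\<close>, merge the other colours: the two-colour theorem of Bessy and
  Thomasse (Lehel's conjecture) applies, and a cycle avoiding \<open>g\<close> keeps its colour at every vertex.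
  Otherwise the palettes are \<open>{p, q}\<close>, \<open>{p, r}\<close>, \<open>{q, r}\<close>. Two classes are joined completely in their
  common colour, so they span a cycle of that colour as soon as both are covered by the same number of
  paths of that colour; a Hamiltonian path of each class that changes colour once bounds these numbers.

  For two colours, take a largest cycle \<open>C\<close>, blue say, whose complement is spanned by a red path
  \<open>P = x x1 x2 \<dots> y\<close>, and suppose there is no solution. A vertex of \<open>C\<close> is red if its edges to \<open>x\<close> and
  \<open>y\<close> are red, and blue otherwise. The neighbours on \<open>C\<close> of a red vertex are joined in red, and the
  successors (predecessors) of the blue vertices form a red clique. Linking the red paths of step two
  on \<open>C\<close> would give a red Hamiltonian cycle unless \<open>C\<close> is even and every second vertex is red. If a
  vertex of the other parity is red, exchanging one of its neighbours with \<open>x1\<close> gives another extremal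
  pair, which contradicts this parity property; if all of them are blue, inserting \<open>x\<close>, \<open>y\<close>,
  \<open>x1\<close> makes \<open>C\<close> longer.
\<close>

section \<open>Monochromatic paths\<close>

definition mono_path :: "('a set \<Rightarrow> 'k) \<Rightarrow> 'k \<Rightarrow> 'a list \<Rightarrow> bool" where
  "mono_path c a xs \<longleftrightarrow> distinct xs \<and> successively (\<lambda>u v. c {u, v} = a) xs"

definition closed_path :: "('a set \<Rightarrow> 'k) \<Rightarrow> 'k \<Rightarrow> 'a list \<Rightarrow> bool" where
  "closed_path c a xs \<longleftrightarrow> mono_path c a xs \<and> xs \<noteq> [] \<and> c {last xs, hd xs} = a"

text \<open>The colour type is arbitrary: the notion serves both the given colouring and the Boolean
  one that merges all colours but one.\<close>

definition spans_cycle :: "('a set \<Rightarrow> 'k) \<Rightarrow> 'k \<Rightarrow> 'a set \<Rightarrow> bool" where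
  "spans_cycle c a S \<longleftrightarrow> finite S \<and> card S \<le> 2 \<or> (\<exists>xs. closed_path c a xs \<and> set xs = S)"

lemma mono_path_rev [simp]: "mono_path c a (rev xs) \<longleftrightarrow> mono_path c a xs"
  by (simp add: mono_path_def insert_commute)

lemma mono_path_Nil [simp]: "mono_path c a []"
  by (simp add: mono_path_def)

lemma mono_path_Cons:
  "mono_path c a (x # xs) \<longleftrightarrow> x \<notin> set xs \<and> mono_path c a xs \<and> (xs = [] \<or> c {x, hd xs} = a)"
  by (auto simp: mono_path_def successively_Cons)

lemma mono_path_append:
  "mono_path c a (xs @ ys) \<longleftrightarrow> mono_path c a xs \<and> mono_path c a ys \<and> set xs \<inter> set ys = {} \<and>
     (xs = [] \<or> ys = [] \<or> c {last xs, hd ys} = a)"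
  by (auto simp: mono_path_def successively_append_iff)

lemma mono_path_tl: "mono_path c a xs \<Longrightarrow> mono_path c a (tl xs)"
  by (cases xs) (auto simp: mono_path_Cons)

lemma mono_path_butlast: "mono_path c a xs \<Longrightarrow> mono_path c a (butlast xs)"
  by (cases xs rule: rev_cases) (auto simp: mono_path_append)

lemma spans_cycleI: "closed_path c a xs \<Longrightarrow> set xs = S \<Longrightarrow> spans_cycle c a S"
  by (auto simp: spans_cycle_def)

lemma spans_cycle_empty [simp]: "spans_cycle c a {}"
  by (simp add: spans_cycle_def)

lemma spans_cycle_imp_mono_cycle:
  assumes "spans_cycle c a S"
  shows "mono_cycle c a S"
proof (cases "finite S \<and> card S \<le> 2")
  case False
  then obtain xs where xs: "closed_path c a xs" "set xs = S"
    using assms by (auto simp: spans_cycle_def)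
  have d: "distinct xs" and s: "successively (\<lambda>u v. c {u, v} = a) xs"
    and ne: "xs \<noteq> []" and l: "c {last xs, hd xs} = a"
    using xs(1) by (auto simp: closed_path_def mono_path_def)
  have len: "3 \<le> length xs"
    using False xs(2) d distinct_card by fastforce
  have "c {xs ! i, xs ! ((i + 1) mod length xs)} = a" if "i < length xs" for i
  proof (cases "Suc i < length xs")
    case True
    then show ?thesis
      using s by (simp add: successively_conv_nth)
  next
    case False
    then have "Suc i = length xs"
      using that by simp
    then show ?thesis
      using l ne by (simp add: last_conv_nth hd_conv_nth flip: \<open>Suc i = length xs\<close>)
  qed
  then show ?thesis
    using d len xs(2) by (auto simp: mono_cycle_def)
qed (simp add: mono_cycle_def)

text \<open>The list is read from its end: \<open>s\<close> is the unfinished segment at the front,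
  \<open>T\<close> a single path through all segments finished so far. At a gap \<open>s\<close>
  leads from \<open>X\<close> to \<open>Y\<close>, so whichever of the two sets contains
  \<open>hd T\<close>, one end of \<open>s\<close> can be attached there.\<close>

lemma link_segments_aux:
  assumes X: "\<And>u v. u \<in> X \<Longrightarrow> v \<in> X \<Longrightarrow> u \<noteq> v \<Longrightarrow> c {u, v} = a"
    and Y: "\<And>u v. u \<in> Y \<Longrightarrow> v \<in> Y \<Longrightarrow> u \<noteq> v \<Longrightarrow> c {u, v} = a"
    and "successively (\<lambda>u v. c {u, v} = a \<or> u \<in> Y \<and> v \<in> X) w"
    and "distinct w" "w \<noteq> []" "last w \<in> Y"
  shows "\<exists>s T. mono_path c a s \<and> mono_path c a T \<and> s \<noteq> [] \<and> set s \<inter> set T = {} \<and>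
           set s \<union> set T = set w \<and> hd s = hd w \<and> last s \<in> Y \<and>
           (T = [] \<or> hd T \<in> X \<union> Y \<and> last T \<in> X \<union> Y)"
  using assms(3-)
proof (induction w)
  case (Cons u w)
  show ?case
  proof (cases "w = []")
    case True
    then show ?thesis
      using Cons.prems by (intro exI[of _ "[u]"] exI[of _ "[]"]) (auto simp: mono_path_Cons)
  next
    case False
    then obtain s T where IH: "mono_path c a s" "mono_path c a T" "s \<noteq> []" "set s \<inter> set T = {}"
        "set s \<union> set T = set w" "hd s = hd w" "last s \<in> Y"
        "T = [] \<or> hd T \<in> X \<union> Y \<and> last T \<in> X \<union> Y"
      using Cons by (auto simp: successively_Cons)
    have u: "u \<notin> set s" "u \<notin> set T"
      using IH(5) Cons.prems by auto
    have step: "c {u, hd s} = a \<or> u \<in> Y \<and> hd s \<in> X"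
      using Cons.prems False IH(6) by (auto simp: successively_Cons)
    show ?thesis
    proof (cases "c {u, hd s} = a")
      case True
      then show ?thesis
        using IH u by (intro exI[of _ "u # s"] exI[of _ T]) (auto simp: mono_path_Cons)
    next
      case False
      then have uY: "u \<in> Y" and sX: "hd s \<in> X"
        using step by auto
      obtain T' where T': "mono_path c a T'" "set T' = set s \<union> set T" "hd T' \<in> X \<union> Y"
          "last T' \<in> X \<union> Y"
      proof (cases "T = []")
        case True
        then show ?thesis
          using that[of s] IH sX by auto
      next
        case ne: False
        have in_s: "hd s \<in> set s" "last s \<in> set s" and in_T: "hd T \<in> set T"
          using IH(3) ne by auto
        then have neq: "hd s \<noteq> hd T" "last s \<noteq> hd T"
          using IH(4) by auto
        show ?thesis
        proof (cases "hd T \<in> Y")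
          case True
          then have "c {last s, hd T} = a"
            using Y IH(7) neq by auto
          then show ?thesis
            using that[of "s @ T"] IH sX ne by (auto simp: mono_path_append)
        next
          case False
          then have "c {hd s, hd T} = a"
            using X IH(8) neq ne sX by auto
          then show ?thesis
            using that[of "rev s @ T"] IH ne by (auto simp: mono_path_append last_rev hd_rev)
        qed
      qed
      show ?thesis
        using T' u uY IH(5) by (intro exI[of _ "[u]"] exI[of _ T']) (auto simp: mono_path_Cons)
    qed
  qed
qed simp

text \<open>The gaps of \<^term>\<open>w\<close> cut it into segments that lead from \<^term>\<open>X\<close> to \<^term>\<open>Y\<close>; reversing
  every other segment, they can be concatenated along edges inside \<^term>\<open>X\<close> and inside \<^term>\<open>Y\<close>.\<close>

lemma link_segments:
  assumes X: "\<And>u v. u \<in> X \<Longrightarrow> v \<in> X \<Longrightarrow> u \<noteq> v \<Longrightarrow> c {u, v} = a"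
    and Y: "\<And>u v. u \<in> Y \<Longrightarrow> v \<in> Y \<Longrightarrow> u \<noteq> v \<Longrightarrow> c {u, v} = a"
    and w: "successively (\<lambda>u v. c {u, v} = a \<or> u \<in> Y \<and> v \<in> X) w"
    and "distinct w" "w \<noteq> []" "hd w \<in> X" "last w \<in> Y"
  obtains T where "mono_path c a T" "T \<noteq> []" "set T = set w" "hd T \<in> X \<union> Y" "last T \<in> X \<union> Y"
proof -
  from link_segments_aux[OF X Y w assms(4,5,7)]
  obtain s T where *: "mono_path c a s" "mono_path c a T" "s \<noteq> []" "set s \<inter> set T = {}"
      "set s \<union> set T = set w" "hd s = hd w" "last s \<in> Y"
      "T = [] \<or> hd T \<in> X \<union> Y \<and> last T \<in> X \<union> Y"
    by auto
  show ?thesis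
  proof (cases "T = []")
    case True
    then show ?thesis
      using that[of s] * assms(6) by auto
  next
    case ne: False
    have "hd s \<in> set s" "last s \<in> set s" "hd T \<in> set T"
      using *(3) ne by auto
    then have neq: "hd s \<noteq> hd T" "last s \<noteq> hd T"
      using *(4) by auto
    show ?thesis
    proof (cases "hd T \<in> Y")
      case True
      then have "c {last s, hd T} = a"
        using Y *(7) neq by auto
      then show ?thesis
        using that[of "s @ T"] * assms(6) ne by (auto simp: mono_path_append)
    next
      case False
      then have "c {hd s, hd T} = a"
        using X *(6,8) neq ne assms(6) by auto
      then show ?thesis
        using that[of "rev s @ T"] * ne by (auto simp: mono_path_append last_rev hd_rev)
    qed
  qed
qed

section \<open>Cycles indexed by the integers\<close>

text \<open>Stride 1 gives runs along the cycle, stride 2 walks through every second vertex.\<close>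

definition arc :: "(int \<Rightarrow> 'a) \<Rightarrow> int \<Rightarrow> int \<Rightarrow> nat \<Rightarrow> 'a list" where
  "arc v d s n = map (\<lambda>j. v (s + d * int j)) [0..<n]"

lemma arc_Nil_iff [simp]: "arc v d s n = [] \<longleftrightarrow> n = 0"
  by (simp add: arc_def)

lemma length_arc [simp]: "length (arc v d s n) = n"
  by (simp add: arc_def)

lemma hd_arc [simp]: "0 < n \<Longrightarrow> hd (arc v d s n) = v s"
  by (simp add: arc_def hd_map)

lemma last_arc [simp]: "0 < n \<Longrightarrow> last (arc v d s n) = v (s + d * (int n - 1))"
  by (simp add: arc_def last_map of_nat_diff)

lemma set_arc: "set (arc v d s n) = (\<lambda>j. v (s + d * int j)) ` {..<n}"
  by (auto simp: arc_def)

lemma successively_arc: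
  "successively R (arc v d s n) \<longleftrightarrow> (\<forall>j. Suc j < n \<longrightarrow> R (v (s + d * int j)) (v (s + d * int j + d)))"
  by (simp add: arc_def successively_conv_nth algebra_simps)

lemma set_arc_1: "set (arc v 1 s n) = v ` {s..<s + int n}"
proof -
  have "{s..<s + int n} = (\<lambda>j. s + int j) ` {..<n}"
  proof
    show "{s..<s + int n} \<subseteq> (\<lambda>j. s + int j) ` {..<n}"
    proof
      fix i
      assume "i \<in> {s..<s + int n}"
      then show "i \<in> (\<lambda>j. s + int j) ` {..<n}"
        by (intro image_eqI[of _ _ "nat (i - s)"]) auto
    qed
  qed auto
  then show ?thesis
    by (simp add: set_arc image_image)
qed

lemma arc_append: "arc v d s (m + n) = arc v d s m @ arc v d (s + d * int m) n"
proof (induction m arbitrary: s)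
  case (Suc m)
  have "arc v d s (Suc n) = v s # arc v d (s + d) n" for s n
    by (simp add: arc_def upt_conv_Cons map_Suc_upt[symmetric] algebra_simps del: upt_Suc)
  then show ?case
    using Suc[of "s + d"] by (simp add: algebra_simps)
qed (simp add: arc_def)

lemma arc_Suc: "arc v d s (Suc n) = v s # arc v d (s + d) n"
  using arc_append[of v d s 1 n] by (simp add: arc_def)

text \<open>Integer positions and a periodic \<open>v\<close> turn rotation and reversal of the
  cycle into substitutions. The case \<open>L = 2\<close> is a doubled edge.\<close>

locale int_cycle =
  fixes c :: "'a set \<Rightarrow> 'k" and k :: 'k and L :: nat and v :: "int \<Rightarrow> 'a"
  assumes two_le: "2 \<le> L"
    and periodic: "v (i + int L) = v i"
    and inj_period: "inj_on v {0..<int L}"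
    and edge: "c {v i, v (i + 1)} = k"
begin

lemma periodic_mult: "v (i + int L * m) = v i"
proof -
  have *: "v (i + int L * int n) = v i" for i n
  proof (induction n)
    case (Suc n)
    have "v (i + int L * int (Suc n)) = v (i + int L * int n + int L)"
      by (simp add: algebra_simps)
    then show ?case
      using Suc periodic by simp
  qed simp
  show ?thesis
  proof (cases "0 \<le> m")
    case True
    then show ?thesis
      using *[of i "nat m"] by simp
  next
    case False
    then show ?thesis
      using *[of "i + int L * m" "nat (- m)"] by simp
  qed
qed

lemma v_mod: "v (i mod int L) = v i"
  using periodic_mult[of "i mod int L" "i div int L"] by (simp add: algebra_simps)

lemma eq_iff: "v i = v j \<longleftrightarrow> i mod int L = j mod int L"
proof
  assume "v i = v j"
  then have "v (i mod int L) = v (j mod int L)"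
    by (simp add: v_mod)
  moreover have "i mod int L \<in> {0..<int L}" "j mod int L \<in> {0..<int L}"
    using two_le by auto
  ultimately show "i mod int L = j mod int L"
    using inj_period by (auto dest: inj_onD)
qed (metis v_mod)

lemma eq_dvd: "v i = v j \<longleftrightarrow> int L dvd i - j"
  by (simp add: eq_iff mod_eq_dvd_iff)

lemma eqI: "i = j + int L \<or> j = i + int L \<Longrightarrow> v i = v j"
  by (auto simp: periodic)

lemma neqI: "i \<noteq> j \<Longrightarrow> \<bar>i - j\<bar> < int L \<Longrightarrow> v i \<noteq> v j"
  using zdvd_imp_le[of "int L" "\<bar>i - j\<bar>"] by (auto simp: eq_dvd)

lemma edge': "j = i + 1 \<or> i = j + 1 \<Longrightarrow> c {v i, v j} = k"
  using edge by (auto simp: insert_commute)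

lemma range_window: "v ` {a..<a + int L} = range v"
proof -
  have "v i \<in> v ` {a..<a + int L}" for i
  proof -
    have "a + (i - a) mod int L \<in> {a..<a + int L}"
      using two_le by auto
    moreover have "v (a + (i - a) mod int L) = v i"
      by (simp add: eq_iff mod_simps)
    ultimately show ?thesis
      by (metis image_eqI)
  qed
  then show ?thesis
    by auto
qed

lemma finite_range: "finite (range v)"
  using range_window[of 0] by (metis finite_atLeastLessThan_int finite_imageI)

lemma card_range: "card (range v) = L"
  using card_image[OF inj_period] range_window[of 0] by simp

lemma mono_path_arc: "n \<le> L \<Longrightarrow> mono_path c k (arc v 1 s n)"
proof -
  assume n: "n \<le> L"
  have "inj_on (\<lambda>j. v (s + int j)) {..<n}"
    by (rule inj_onI, rule ccontr) (use neqI n in fastforce)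
  then have "distinct (arc v 1 s n)"
    by (simp add: arc_def distinct_map atLeast0LessThan)
  then show ?thesis
    by (simp add: mono_path_def successively_arc edge)
qed

lemma set_arc_L: "set (arc v 1 s L) = range v"
  by (simp add: set_arc_1 range_window)

lemma set_arc_L1:
  "s = i + 1 \<Longrightarrow> set (arc v 1 s (L - 1)) = range v - {v i}"
proof -
  have "{i..<i + int L} = insert i {i + 1..<i + 1 + int (L - 1)}"
    using two_le by auto
  then have *: "range v = insert (v i) (v ` {i + 1..<i + 1 + int (L - 1)})"
    by (metis image_insert range_window)
  have "v i \<notin> v ` {i + 1..<i + 1 + int (L - 1)}"
    using neqI two_le by fastforce
  then show "s = i + 1 \<Longrightarrow> ?thesis"
    using * by (auto simp: set_arc_1)
qed

lemma set_arc_L2: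
  assumes "s = i + 2"
  shows "set (arc v 1 s (L - 2)) = range v - {v i, v (i + 1)}"
proof -
  have "{i..<i + int L} = insert i (insert (i + 1) {i + 2..<i + 2 + int (L - 2)})"
    using two_le by auto
  then have *: "range v = insert (v i) (insert (v (i + 1)) (v ` {i + 2..<i + 2 + int (L - 2)}))"
    by (metis image_insert range_window)
  have "v i \<notin> v ` {i + 2..<i + 2 + int (L - 2)}" "v (i + 1) \<notin> v ` {i + 2..<i + 2 + int (L - 2)}"
    using neqI two_le by fastforce+
  then show ?thesis
    using * assms by (auto simp: set_arc_1)
qed

text \<open>With \<open>reflect\<close>, this symmetry lets later arguments work at position 0 and
  in one direction only.\<close>

lemma shift: "int_cycle c k L (\<lambda>i. v (i + s))"
proof
  show "v (i + int L + s) = v (i + s)" for i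
    by (rule eqI) auto
  show "inj_on (\<lambda>i. v (i + s)) {0..<int L}"
    by (rule inj_onI, rule ccontr) (use neqI in fastforce)
  show "c {v (i + s), v (i + 1 + s)} = k" for i
    by (rule edge') auto
qed (rule two_le)

lemma reflect: "int_cycle c k L (\<lambda>i. v (- i))"
proof
  show "v (- (i + int L)) = v (- i)" for i
    by (rule eqI) auto
  show "inj_on (\<lambda>i. v (- i)) {0..<int L}"
    by (rule inj_onI, rule ccontr) (use neqI in fastforce)
  show "c {v (- i), v (- (i + 1))} = k" for i
    by (rule edge') auto
qed (rule two_le)

text \<open>The test compares vertices and not positions, so every position congruent to
  \<open>m\<close> modulo \<open>L\<close> is changed at once.\<close>

lemma replace:
  assumes "y \<notin> range v" "c {v (m - 1), y} = k" "c {y, v (m + 1)} = k"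
  shows "int_cycle c k L (\<lambda>i. if v i = v m then y else v i)"
proof
  show "(if v (i + int L) = v m then y else v (i + int L)) = (if v i = v m then y else v i)" for i
    by (simp add: periodic)
  show "inj_on (\<lambda>i. if v i = v m then y else v i) {0..<int L}"
  proof (rule inj_onI)
    fix i j
    assume ij: "i \<in> {0..<int L}" "j \<in> {0..<int L}"
      and eq: "(if v i = v m then y else v i) = (if v j = v m then y else v j)"
    have "v i \<noteq> y" for i
      using assms(1) by auto
    then have "v i = v j"
      using eq by (metis (full_types))
    then show "i = j"
      using inj_period ij by (auto dest: inj_onD)
  qed
  fix i
  have "v (i + 1) \<noteq> v i"
    using neqI[of "i + 1" i] two_le by auto
  moreover have "v (i + 1) = v (m + 1)" if "v i = v m"
    using that by (simp add: eq_dvd)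
  moreover have "v i = v (m - 1)" if "v (i + 1) = v m"
    using that by (simp add: eq_dvd algebra_simps)
  ultimately show "c {if v i = v m then y else v i, if v (i + 1) = v m then y else v (i + 1)} = k"
    using assms(2,3) edge by auto
qed (rule two_le)

end

lemma closed_path_imp_int_cycle:
  assumes "closed_path c k xs" "2 \<le> length xs"
  obtains v where "int_cycle c k (length xs) v" "range v = set xs"
proof -
  let ?L = "int (length xs)"
  let ?v = "\<lambda>i. xs ! nat (i mod ?L)"
  have d: "distinct xs" and s: "successively (\<lambda>u v. c {u, v} = k) xs"
    and ne: "xs \<noteq> []" and l: "c {last xs, hd xs} = k"
    using assms(1) by (auto simp: closed_path_def mono_path_def)
  have lt: "nat (i mod ?L) < length xs" for i
    using ne by (simp add: nat_less_iff)
  have "int_cycle c k (length xs) ?v"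
  proof
    show "inj_on ?v {0..<?L}"
    proof (rule inj_onI)
      fix i j
      assume ij: "i \<in> {0..<?L}" "j \<in> {0..<?L}" and eq: "?v i = ?v j"
      then have "nat (i mod ?L) = nat (j mod ?L)"
        using d lt nth_eq_iff_index_eq by blast
      then show "i = j"
        using ij by auto
    qed
    fix i
    show "c {?v i, ?v (i + 1)} = k"
    proof (cases "i mod ?L = ?L - 1")
      case True
      then have "(i + 1) mod ?L = 0"
        using mod_add_left_eq[of i ?L 1] by simp
      moreover have "nat (?L - 1) = length xs - 1"
        by simp
      ultimately show ?thesis
        using l ne True by (simp add: last_conv_nth hd_conv_nth)
    next
      case False
      have "0 \<le> i mod ?L" "i mod ?L < ?L"
        using ne by auto
      then have eq: "(i + 1) mod ?L = i mod ?L + 1"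
        using False mod_pos_pos_trivial[of "i mod ?L + 1" ?L] by (simp add: mod_simps)
      have "nat (i mod ?L + 1) = Suc (nat (i mod ?L))"
        using \<open>0 \<le> i mod ?L\<close> by simp
      then show ?thesis
        using s eq lt[of "i + 1"] by (simp add: successively_conv_nth)
    qed
  qed (use assms(2) in auto)
  moreover have "range ?v = set xs"
  proof
    show "range ?v \<subseteq> set xs"
      using lt by auto
    show "set xs \<subseteq> range ?v"
    proof
      fix y
      assume "y \<in> set xs"
      then obtain n where "n < length xs" "xs ! n = y"
        by (auto simp: in_set_conv_nth)
      then show "y \<in> range ?v"
        by (intro range_eqI[of _ _ "int n"]) simp
    qed
  qed
  ultimately show ?thesis
    using that by blast
qed

section \<open>Extremal configurations\<close>

definition two_cycles :: "('a set \<Rightarrow> bool) \<Rightarrow> 'a set \<Rightarrow> bool" where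
  "two_cycles c V \<longleftrightarrow>
     (\<exists>k S T. spans_cycle c k S \<and> spans_cycle c (\<not> k) T \<and> S \<inter> T = {} \<and> S \<union> T = V)"

text \<open>Colour \<^term>\<open>k\<close> is blue and \<^term>\<open>\<not> k\<close> is red; maximality is over cycles of either colour.\<close>

locale extremal = int_cycle c k L v
  for c :: "'a set \<Rightarrow> bool" and k L v +
  fixes P :: "'a list" and V :: "'a set"
  assumes path: "mono_path c (\<not> k) P"
    and disj: "range v \<inter> set P = {}"
    and cover: "range v \<union> set P = V"
    and maximal: "closed_path c k' D \<Longrightarrow> mono_path c (\<not> k') R \<Longrightarrow> set D \<inter> set R = {} \<Longrightarrow>
      set D \<union> set R = V \<Longrightarrow> length D \<le> L"
    and unsolved: "\<not> two_cycles c V"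
begin

lemma shift_extremal: "extremal c k L (\<lambda>i. v (i + s)) P V"
proof -
  interpret s: int_cycle c k L "\<lambda>i. v (i + s)"
    by (rule shift)
  have "range (\<lambda>i. v (i + s)) = range v"
    by (force intro: image_eqI[of _ _ "_ - s"])
  then show ?thesis
    by unfold_locales (use path disj cover maximal unsolved in auto)
qed

lemma reflect_extremal: "extremal c k L (\<lambda>i. v (- i)) P V"
proof -
  interpret s: int_cycle c k L "\<lambda>i. v (- i)"
    by (rule reflect)
  have "range (\<lambda>i. v (- i)) = range v"
    by (force intro: image_eqI[of _ _ "- _"])
  then show ?thesis
    by unfold_locales (use path disj cover maximal unsolved in auto)
qed

lemma rev_extremal: "extremal c k L v (rev P) V"
  by unfold_locales (use path disj cover maximal unsolved in auto)

lemma solve: "spans_cycle c k S \<Longrightarrow> spans_cycle c (\<not> k) T \<Longrightarrow> S \<inter> T = {} \<Longrightarrow> S \<union> T = V \<Longrightarrow> False"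
  using unsolved by (auto simp: two_cycles_def)

lemma closed_path_arc: "closed_path c k (arc v 1 s L)"
proof -
  have "c {v (s + int L - 1), v s} = k"
    using edge'[of "s + int L" "s + int L - 1"] periodic[of s] by (simp add: insert_commute)
  then show ?thesis
    using two_le by (simp add: closed_path_def mono_path_arc algebra_simps)
qed

text \<open>A path on at most two vertices is a cycle by convention and would form a solution
  together with the blue cycle.\<close>

lemma length_P: "3 \<le> length P"
proof (rule ccontr)
  assume "\<not> 3 \<le> length P"
  then have "card (set P) \<le> 2"
    using card_length[of P] by simp
  then have "spans_cycle c (\<not> k) (set P)"
    by (simp add: spans_cycle_def)
  then show False
    using solve spans_cycleI[OF closed_path_arc set_arc_L] disj cover by blast
qed

abbreviation x where "x \<equiv> hd P"
abbreviation y where "y \<equiv> last P"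
abbreviation x1 where "x1 \<equiv> P ! 1"
abbreviation Q where "Q \<equiv> drop 2 P"
abbreviation x2 where "x2 \<equiv> hd Q"

lemma P_eq: "P = x # x1 # Q"
  using length_P by (cases P; cases "tl P") auto

lemma Q_ne: "Q \<noteq> []"
  using length_P by simp

lemma last_Q: "last Q = y"
  using Q_ne by simp

lemma P_distinct: "x \<noteq> x1" "x \<notin> set Q" "x1 \<notin> set Q" "x \<noteq> y" "x1 \<noteq> y"
proof -
  have d: "distinct (x # x1 # Q)"
    using path P_eq by (metis mono_path_def)
  show "x \<noteq> x1" "x \<notin> set Q" "x1 \<notin> set Q"
    using d by auto
  then show "x \<noteq> y" "x1 \<noteq> y"
    using last_Q Q_ne last_in_set by metis+
qed

lemma P_path: "mono_path c (\<not> k) Q" "c {x, x1} = (\<not> k)" "c {x1, x2} = (\<not> k)"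
proof -
  have "mono_path c (\<not> k) (x # x1 # Q)"
    using path P_eq by metis
  then show "mono_path c (\<not> k) Q" "c {x, x1} = (\<not> k)" "c {x1, x2} = (\<not> k)"
    using Q_ne by (auto simp: mono_path_Cons)
qed

lemma set_P: "set P = insert x (insert x1 (set Q))"
  by (subst P_eq) simp

lemma V_eq: "V = range v \<union> insert x (insert x1 (set Q))"
  using cover set_P by simp

lemma off_P: "v i \<notin> set P"
  using disj by auto

lemma off_cycle: "v i \<noteq> x" "v i \<noteq> x1" "v i \<noteq> y" "v i \<notin> set Q" "x \<notin> range v" "x1 \<notin> range v" "y \<notin> range v"
proof -
  have "P \<noteq> []"
    using length_P by auto
  then have in_P: "x \<in> set P" "y \<in> set P" "x1 \<in> set P" "set Q \<subseteq> set P"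
    using length_P by (auto dest: in_set_dropD)
  then show "v i \<noteq> x" "v i \<noteq> x1" "v i \<noteq> y" "v i \<notin> set Q"
    using off_P[of i] by (metis, metis, metis, blast)
  show "x \<notin> range v" "x1 \<notin> range v" "y \<notin> range v"
    using in_P disj by blast+
qed

text \<open>A red edge between the ends would close \<open>P\<close> to a red cycle that complements
  the blue one.\<close>

lemma end_edge: "c {x, y} = k"
proof (rule ccontr)
  assume "c {x, y} \<noteq> k"
  then have "closed_path c (\<not> k) P"
    using path length_P by (auto simp: closed_path_def insert_commute)
  then show False
    using solve[OF spans_cycleI[OF closed_path_arc set_arc_L] spans_cycleI] disj cover by blast
qed

section \<open>Red and blue vertices of the cycle\<close>

definition red :: "int \<Rightarrow> bool" where
  "red i \<longleftrightarrow> c {x, v i} = (\<not> k) \<and> c {y, v i} = (\<not> k)"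

lemma red_cong: "v i = v j \<Longrightarrow> red i = red j"
  by (simp add: red_def)

lemma blue_cases:
  assumes "\<not> red i"
  obtains "c {x, v i} = k" | "c {y, v i} = k"
  using assms by (auto simp: red_def)

text \<open>A vertex that is not red is joined in blue to at least one end of \<open>P\<close>. A
  blue chord between the successors of two such vertices would turn the cycle into a blue path
  between them; inserting \<open>x\<close>, \<open>y\<close> or the blue edge \<open>xy\<close>
  closes a longer blue cycle, and the rest of \<open>P\<close> stays a red path.\<close>

lemma blue_succ_aux:
  assumes "\<not> red 0" "\<not> red (int j)" "0 < j" "j < L"
  shows "c {v 1, v (int j + 1)} = (\<not> k)"
proof (rule ccontr)
  assume "c {v 1, v (int j + 1)} \<noteq> (\<not> k)"
  then have blue: "c {v 1, v (int j + 1)} = k"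
    by auto
  \<comment> \<open>The path runs backwards from \<open>v j\<close> to \<open>v 1\<close>, takes the
    chord to \<open>v (j + 1)\<close> and goes on to \<open>v L = v 0\<close>.\<close>
  define A where "A = rev (arc v 1 1 j) @ arc v 1 (int j + 1) (L - j)"
  have dis: "v ` {1..<1 + int j} \<inter> v ` {int j + 1..<1 + int L} = {}"
    using neqI assms by fastforce
  have "{1..<1 + int j} \<union> {int j + 1..<1 + int L} = {1..<1 + int L}"
    using assms by auto
  then have un: "v ` {1..<1 + int j} \<union> v ` {int j + 1..<1 + int L} = range v"
    using range_window[of 1] by (metis image_Un)
  have A: "mono_path c k A" "A \<noteq> []" "hd A = v (int j)" "last A = v 0" "set A = range v"
    using assms dis un blue mono_path_arc eqI[of "int L" 0]
    by (auto simp: A_def mono_path_append hd_rev last_rev set_arc_1)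
  have off: "x \<notin> set A" "y \<notin> set A" "length A = L"
    using A(5) off_cycle assms by (auto simp: A_def)
  \<comment> \<open>\<open>B\<close> is the piece inserted between the two ends of \<open>A\<close>,
    and \<open>R\<close> is the red path left over from \<open>P\<close>.\<close>
  have longer: False if "mono_path c k B" "B \<noteq> []" "set B = set P - set R" "mono_path c (\<not> k) R"
      "set R \<subseteq> set P" "c {hd B, v 0} = k" "c {last B, v (int j)} = k" for B R
  proof -
    have "closed_path c k (B @ A)"
      using that A disj by (auto simp: closed_path_def mono_path_append insert_commute)
    then have "length (B @ A) \<le> L"
      using that A(5) disj cover by (intro maximal[of _ _ R]) auto
    then show False
      using off(3) that(2) by simp
  qed
  note x_out = longer[of "[x]" "tl P"] and y_out = longer[of "[y]" "butlast P"]
    and xy_out = longer[of _ "butlast (tl P)"]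
  have tl_P: "set (tl P) = set P - {x}" "mono_path c (\<not> k) (tl P)"
    using path length_P by (cases P; auto simp: mono_path_Cons)+
  have "distinct P"
    using path by (simp add: mono_path_def)
  then have bl_P: "set (butlast P) = set P - {y}" "mono_path c (\<not> k) (butlast P)"
    using mono_path_butlast[OF path] length_P by (cases P rule: rev_cases; auto)+
  have bt_P: "set (butlast (tl P)) = set P - {x, y}" "mono_path c (\<not> k) (butlast (tl P))"
  proof -
    have "set (butlast (tl P)) = set (tl P) - {last (tl P)}"
      using distinct_tl[OF \<open>distinct P\<close>] length_P by (cases "tl P" rule: rev_cases) auto
    moreover have "last (tl P) = y"
      using length_P by (cases P) auto
    ultimately show "set (butlast (tl P)) = set P - {x, y}"
      using tl_P by auto
    show "mono_path c (\<not> k) (butlast (tl P))"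
      by (intro mono_path_butlast mono_path_tl path)
  qed
  have inP: "x \<in> set P" "y \<in> set P"
    using length_P by (cases P; auto)+
  have xy: "c {y, x} = k"
    using end_edge by (simp add: insert_commute)
  show False
    using assms(1)
  proof (cases rule: blue_cases)
    case 1
    show ?thesis
      using assms(2)
    proof (cases rule: blue_cases)
      case 1
      then show ?thesis
        using x_out \<open>c {x, v 0} = k\<close> tl_P inP by (auto simp: mono_path_Cons)
    next
      case 2
      show ?thesis
        by (rule xy_out[of "[x, y]"])
          (use 2 \<open>c {x, v 0} = k\<close> bt_P inP end_edge P_distinct in \<open>auto simp: mono_path_Cons\<close>)
    qed
  next
    case 2
    show ?thesis
      using assms(2)
    proof (cases rule: blue_cases)
      case 1
      show ?thesis
        by (rule xy_out[of "[y, x]"])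
          (use 1 \<open>c {y, v 0} = k\<close> bt_P inP xy P_distinct in \<open>auto simp: mono_path_Cons\<close>)
    next
      case 2
      then show ?thesis
        using y_out \<open>c {y, v 0} = k\<close> bl_P inP by (auto simp: mono_path_Cons)
    qed
  qed
qed

lemma blue_succ:
  assumes "\<not> red i" "\<not> red j" "v i \<noteq> v j"
  shows "c {v (i + 1), v (j + 1)} = (\<not> k)"
proof -
  interpret s: extremal c k L "\<lambda>n. v (n + i)" P V
    by (rule shift_extremal)
  define d where "d = nat ((j - i) mod int L)"
  have d: "int d = (j - i) mod int L"
    using two_le by (simp add: d_def)
  have eq: "v (int d + i) = v j" "v (int d + 1 + i) = v (j + 1)"
  proof -
    have "int L dvd int d - (j - i)"
      by (simp add: d flip: mod_eq_dvd_iff)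
    then show "v (int d + i) = v j" "v (int d + 1 + i) = v (j + 1)"
      by (simp_all add: eq_dvd algebra_simps)
  qed
  have "d \<noteq> 0"
    using assms(3) eq(1) by (intro notI) simp
  moreover have "int d < int L"
    unfolding d using two_le by simp
  moreover have "\<not> s.red 0" "\<not> s.red (int d)"
    using assms eq by (auto simp: s.red_def red_def)
  ultimately show ?thesis
    using s.blue_succ_aux[of d] eq by (simp add: add.commute)
qed

lemma blue_pred:
  assumes "\<not> red i" "\<not> red j" "v i \<noteq> v j"
  shows "c {v (i - 1), v (j - 1)} = (\<not> k)"
proof -
  interpret s: extremal c k L "\<lambda>n. v (- n)" P V
    by (rule reflect_extremal)
  show ?thesis
    using s.blue_succ[of "- i" "- j"] assms by (simp add: s.red_def red_def)
qed

text \<open>The successors of two consecutive blue vertices are themselves consecutive, hence joined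
  by a blue edge, against \<open>blue_succ\<close>.\<close>

lemma red_alternative: "red i \<or> red (i + 1)"
  using blue_succ[of i "i + 1"] edge[of "i + 1"] neqI[of i "i + 1"] two_le by auto

text \<open>A red vertex closes \<open>P\<close> to a red cycle; if its neighbours on the cycle were
  joined in blue, bypassing it would leave a blue cycle on the rest.\<close>

lemma red_skip:
  assumes "red i"
  shows "c {v (i - 1), v (i + 1)} = (\<not> k)"
proof (rule ccontr)
  assume "c {v (i - 1), v (i + 1)} \<noteq> (\<not> k)"
  then have blue: "c {v (i - 1), v (i + 1)} = k"
    by auto
  have eq: "v (i + (int L - 1)) = v (i - 1)"
    by (rule eqI) auto
  have "closed_path c k (arc v 1 (i + 1) (L - 1))"
    using two_le blue eq by (simp add: closed_path_def mono_path_arc algebra_simps)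
  then have 1: "spans_cycle c k (range v - {v i})"
    using set_arc_L1 by (blast intro: spans_cycleI)
  have "closed_path c (\<not> k) (v i # P)"
    using assms path off_P length_P by (auto simp: closed_path_def mono_path_Cons red_def insert_commute)
  then have 2: "spans_cycle c (\<not> k) (insert (v i) (set P))"
    by (auto intro: spans_cycleI)
  show False
    by (rule solve[OF 1 2]) (use disj cover in auto)
qed

lemma four_le: "4 \<le> L"
proof (rule ccontr)
  assume "\<not> 4 \<le> L"
  obtain i where "red i"
    using red_alternative by blast
  have "card (range v - {v i}) \<le> 2"
    using card_range finite_range \<open>\<not> 4 \<le> L\<close> by simp
  then have 1: "spans_cycle c k (range v - {v i})"
    using finite_range by (simp add: spans_cycle_def)
  have "closed_path c (\<not> k) (v i # P)"
    using \<open>red i\<close> path off_P length_P by (auto simp: closed_path_def mono_path_Cons red_def insert_commute)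
  then have 2: "spans_cycle c (\<not> k) (insert (v i) (set P))"
    by (auto intro: spans_cycleI)
  show False
    by (rule solve[OF 1 2]) (use disj cover in auto)
qed

section \<open>Linking red walks on the cycle\<close>

definition red_ends :: "'a list \<Rightarrow> bool" where
  "red_ends T \<longleftrightarrow> mono_path c (\<not> k) T \<and> T \<noteq> [] \<and> (\<exists>i. hd T = v i \<and> red i) \<and> (\<exists>i. last T = v i \<and> red i)"

text \<open>Red ends are joined in red to \<open>x\<close> and \<open>y\<close>, so \<open>T\<close>
  and \<open>P\<close> close up to a red cycle, and a blue cycle on the remaining vertices completes
  a solution.\<close>

lemma no_red_ends:
  assumes "red_ends T" "set T \<subseteq> range v" "spans_cycle c k (range v - set T)"
  shows False
proof -
  have "closed_path c (\<not> k) (T @ P)"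
    using assms(1,2) path disj length_P
    by (cases "P = []") (auto simp: red_ends_def closed_path_def mono_path_append red_def insert_commute)
  then have "spans_cycle c (\<not> k) (set T \<union> set P)"
    by (auto intro: spans_cycleI)
  from solve[OF assms(3) this] show False
    using assms(2) disj cover by auto
qed

text \<open>Besides red edges it admits the gaps that \<open>link_segments\<close> can bridge, from
  a predecessor of a blue vertex to a successor of one.\<close>

definition skip :: "'a \<Rightarrow> 'a \<Rightarrow> bool" where
  "skip u w \<longleftrightarrow> c {u, w} = (\<not> k) \<or> (\<exists>i j. \<not> red i \<and> \<not> red j \<and> u = v (i - 1) \<and> w = v (j + 1))"

text \<open>The vertex jumped over decides: if it is red, \<open>red_skip\<close> gives a red edge;
  if it is blue, the jump is an admissible gap.\<close>

lemma skip_step: "j = i + 2 \<Longrightarrow> skip (v i) (v j)"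
  using red_skip[of "i + 1"] by (force simp: skip_def algebra_simps)

text \<open>The successors \<open>?X\<close> and the predecessors \<open>?Y\<close> of blue vertices
  are red cliques by \<open>blue_succ\<close> and \<open>blue_pred\<close>, so
  \<open>link_segments\<close> applies. The ends it yields lie in these sets and are red by
  \<open>red_alternative\<close>. Without blue vertices there are no gaps, and \<open>w\<close>
  itself is the path.\<close>

lemma link:
  assumes "successively skip w" "distinct w" "w \<noteq> []" "hd w = v (g + 1)" "last w = v (h - 1)"
    and gh: "\<not> red g \<and> \<not> red h \<or> (\<forall>i. red i)"
  obtains T where "red_ends T" "set T = set w"
proof (cases "\<forall>i. red i")
  case True
  then have "skip = (\<lambda>u w. c {u, w} = (\<not> k))"
    by (auto simp: skip_def fun_eq_iff)
  then show ?thesis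
    using that[of w] assms True by (auto simp: red_ends_def mono_path_def)
next
  case False
  let ?X = "{v (i + 1) |i. \<not> red i}" and ?Y = "{v (i - 1) |i. \<not> red i}"
  have X: "c {u, w} = (\<not> k)" if uw: "u \<in> ?X" "w \<in> ?X" "u \<noteq> w" for u w
  proof -
    obtain i where i: "u = v (i + 1)" "\<not> red i"
      using uw(1) by blast
    obtain j where j: "w = v (j + 1)" "\<not> red j"
      using uw(2) by blast
    note ij = i j
    then show ?thesis
      using blue_succ[of i j] that(3) ij by (auto simp: eq_dvd)
  qed
  have Y: "c {u, w} = (\<not> k)" if uw: "u \<in> ?Y" "w \<in> ?Y" "u \<noteq> w" for u w
  proof -
    obtain i where i: "u = v (i - 1)" "\<not> red i"
      using uw(1) by blast
    obtain j where j: "w = v (j - 1)" "\<not> red j"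
      using uw(2) by blast
    note ij = i j
    then show ?thesis
      using blue_pred[of i j] that(3) ij by (auto simp: eq_dvd)
  qed
  have w: "successively (\<lambda>u w. c {u, w} = (\<not> k) \<or> u \<in> ?Y \<and> w \<in> ?X) w"
    using assms(1) by (rule successively_mono) (auto simp: skip_def)
  have ends: "hd w \<in> ?X" "last w \<in> ?Y"
    using assms False by auto
  obtain T where T: "mono_path c (\<not> k) T" "T \<noteq> []" "set T = set w" "hd T \<in> ?X \<union> ?Y" "last T \<in> ?X \<union> ?Y"
    using link_segments[of ?X c "\<not> k" ?Y w, OF X Y w assms(2,3) ends] by blast
  have red: "\<exists>i. u = v i \<and> red i" if u: "u \<in> ?X \<union> ?Y" for u
  proof -
    consider i where "u = v (i + 1)" "\<not> red i" | i where "u = v (i - 1)" "\<not> red i"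
      using u by blast
    then show ?thesis
    proof cases
      case 1
      then show ?thesis
        using red_alternative[of i] by blast
    next
      case 2
      then show ?thesis
        using red_alternative[of "i - 1"] by auto
    qed
  qed
  show ?thesis
    using that[of T] T red by (auto simp: red_ends_def)
qed

section \<open>Steps of length two and the parity of the cycle\<close>

lemma distinct_stride:
  assumes "odd L \<and> n \<le> L \<or> 2 * n \<le> L"
  shows "distinct (arc v 2 s n)"
proof -
  have "inj_on (\<lambda>j. v (s + 2 * int j)) {0..<n}"
  proof (rule inj_onI, rule ccontr)
    fix i j
    assume ij: "i \<in> {0..<n}" "j \<in> {0..<n}" "i \<noteq> j" and eq: "v (s + 2 * int i) = v (s + 2 * int j)"
    have dvd: "int L dvd 2 * (int i - int j)"
      using eq by (simp add: eq_dvd algebra_simps)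
    show False
    proof (cases "2 * n \<le> L")
      case True
      then have "v (s + 2 * int i) \<noteq> v (s + 2 * int j)"
        using ij by (intro neqI) auto
      then show False
        using eq by simp
    next
      case False
      then have "odd L" "n \<le> L"
        using assms by auto
      \<comment> \<open>For odd \<open>L\<close> doubling is injective modulo \<open>L\<close>, so
        the walk may go around twice without repetition.\<close>
      then have "coprime (int L) 2"
        by simp
      then have "int L dvd int i - int j"
        using dvd coprime_dvd_mult_right_iff by blast
      moreover have "\<bar>int i - int j\<bar> < int L" "int i - int j \<noteq> 0"
        using ij \<open>n \<le> L\<close> by auto
      ultimately show False
        using zdvd_imp_le[of "int L" "\<bar>int i - int j\<bar>"] by auto
    qed
  qed
  then show ?thesis
    by (simp add: arc_def distinct_map)
qed

lemma successively_skip_stride: "successively skip (arc v 2 s n)"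
  by (auto simp: successively_arc intro: skip_step)

lemma set_stride:
  assumes "L = 2 * m"
  shows "set (arc v 2 s m) = v ` {i. even (i - s)}"
proof
  show "set (arc v 2 s m) \<subseteq> v ` {i. even (i - s)}"
    by (auto simp: set_arc)
  show "v ` {i. even (i - s)} \<subseteq> set (arc v 2 s m)"
  proof clarify
    fix i
    assume "even (i - s)"
    then obtain t where t: "i = s + 2 * t"
      by (metis dvdE diff_eq_eq add.commute)
    have m: "0 < int m"
      using two_le assms by simp
    have "v i = v (s + 2 * (t mod int m))"
    proof -
      have "i - (s + 2 * (t mod int m)) = 2 * (t - t mod int m)"
        by (simp add: t algebra_simps)
      also have "\<dots> = int L * (t div int m)"
        by (simp add: assms minus_mod_eq_mult_div)
      finally show ?thesis
        by (simp add: eq_dvd)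
    qed
    moreover have "nat (t mod int m) < m" "int (nat (t mod int m)) = t mod int m"
      using m by (auto simp: nat_less_iff)
    ultimately show "v i \<in> set (arc v 2 s m)"
      unfolding set_arc by (intro image_eqI[of _ _ "nat (t mod int m)"]) auto
  qed
qed

lemma parity_disjoint:
  assumes "even L" "even i" "odd j"
  shows "v i \<noteq> v j"
proof
  assume "v i = v j"
  then have "int L dvd i - j"
    by (simp add: eq_dvd)
  moreover have "2 dvd int L"
    using assms(1) by simp
  ultimately have "2 dvd i - j"
    by (rule dvd_trans[rotated])
  then show False
    using assms by auto
qed

text \<open>On an odd cycle the steps of length two reach every vertex; linking them gives a red
  path with red ends through the whole cycle, and the blue cycle is empty.\<close>

lemma even_L: "even L"
proof (rule ccontr)
  assume odd: "odd L"
  \<comment> \<open>Starting just after a blue vertex makes the walk end just before it, as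
    \<open>link\<close> demands; if none is blue, any start will do.\<close>
  obtain g where g: "\<not> red g \<or> (\<forall>i. red i)"
    by blast
  let ?w = "arc v 2 (g + 1) L"
  have "last ?w = v (g - 1)"
  proof -
    have "v (g + 1 + 2 * (int L - 1)) = v (g - 1)"
      by (simp add: eq_dvd)
    then show ?thesis
      using two_le by simp
  qed
  then obtain T where T: "red_ends T" "set T = set ?w"
    using link[of ?w g] g odd two_le distinct_stride successively_skip_stride by auto
  have "distinct ?w"
    using distinct_stride odd by blast
  then have "card (set ?w) = L"
    by (simp add: distinct_card)
  moreover have "set ?w \<subseteq> range v"
    by (auto simp: set_arc)
  ultimately have "set ?w = range v"
    using card_range finite_range card_subset_eq by metis
  then show False
    using no_red_ends[of T] T by simp
qed

lemma last_stride:
  assumes "L = 2 * m"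
  shows "last (arc v 2 (g + 1) m) = v (g - 1)"
proof -
  have "v (g + 1 + 2 * (int m - 1)) = v (g - 1)"
    by (rule eqI) (use assms in auto)
  then show ?thesis
    using two_le assms by simp
qed

text \<open>With blue vertices of both parities, one class is walked from \<open>i + 1\<close> to
  \<open>i - 1\<close> and the other from \<open>j + 1\<close> to \<open>j - 1\<close>. The passage
  from \<open>v (i - 1)\<close> to \<open>v (j + 1)\<close> is an admissible gap, so the whole cycle
  is linked into one red path.\<close>

lemma red_parity: "(\<forall>i. even i \<longrightarrow> red i) \<or> (\<forall>i. odd i \<longrightarrow> red i)"
proof (rule ccontr)
  assume "\<not> ?thesis"
  then obtain i j where ij: "even i" "\<not> red i" "odd j" "\<not> red j"
    by blast
  obtain m where m: "L = 2 * m"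
    using even_L by blast
  have "0 < m"
    using m two_le by simp
  let ?w = "arc v 2 (i + 1) m @ arc v 2 (j + 1) m"
  have sets: "set (arc v 2 (i + 1) m) = v ` {i. odd i}" "set (arc v 2 (j + 1) m) = v ` {i. even i}"
    using set_stride[OF m] ij by auto
  have dw: "distinct ?w"
    using distinct_stride[of m] m sets by (auto dest: parity_disjoint[OF even_L, rotated])
  have "skip (v (i - 1)) (v (j + 1))"
    using ij by (auto simp: skip_def)
  then have sw: "successively skip ?w"
    using \<open>0 < m\<close> last_stride[OF m]
    by (simp add: successively_append_iff successively_skip_stride del: last_arc)
  have "hd ?w = v (i + 1)" "last ?w = v (j - 1)"
    using \<open>0 < m\<close> last_stride[OF m] by (auto simp del: last_arc)
  then obtain T where "red_ends T" "set T = set ?w"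
    using link[OF sw dw] ij \<open>0 < m\<close> by auto
  moreover have "set ?w = range v"
    using sets by auto
  ultimately show False
    using no_red_ends[of T] by simp
qed

lemma ex_gap: obtains g where "\<not> red g \<or> (\<forall>i. red i)"
  by blast

lemma parity_path:
  assumes "L = 2 * m" "\<not> red g \<or> (\<forall>i. red i)"
  obtains T where "red_ends T" "set T = v ` {i. odd (i - g)}"
proof -
  have "0 < m"
    using assms two_le by simp
  then obtain T where "red_ends T" "set T = set (arc v 2 (g + 1) m)"
    using link[of "arc v 2 (g + 1) m" g g] last_stride[OF assms(1), of g] assms distinct_stride[of m]
      successively_skip_stride by (auto simp del: last_arc)
  then show ?thesis
    using that set_stride[OF assms(1), of "g + 1"] by simp
qed

text \<open>For \<open>L = 4\<close> one parity class is linked into a red path and the other has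
  two vertices, a cycle by convention.\<close>

lemma six_le: "6 \<le> L"
proof (rule ccontr)
  assume "\<not> 6 \<le> L"
  then have L: "L = 2 * 2"
    using four_le even_L by (auto elim!: evenE)
  obtain g where "\<not> red g \<or> (\<forall>i. red i)"
    by (rule ex_gap)
  then obtain T where T: "red_ends T" "set T = v ` {i. odd (i - g)}"
    using parity_path L by blast
  have "range v - set T \<subseteq> v ` {i. even (i - g)}"
    using T(2) by auto
  moreover have "card (v ` {i. even (i - g)}) \<le> 2"
    using set_stride[OF L, of g] card_length[of "arc v 2 g 2"] by simp
  ultimately have "card (range v - set T) \<le> 2"
    using finite_range by (meson card_mono finite_subset image_subset_iff le_trans rangeI)
  then have "spans_cycle c k (range v - set T)"
    using finite_range by (simp add: spans_cycle_def)
  then show False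
    using no_red_ends[OF T(1)] T(2) by blast
qed

section \<open>Odd vertices red, some even vertex red\<close>

lemma cross_edges:
  assumes "\<And>i. odd i \<Longrightarrow> red i" "red 0"
  shows "c {v (- 2), v 1} = k \<or> c {v 2, v (- 1)} = k"
proof (rule ccontr)
  assume "\<not> ?thesis"
  then have cross: "c {v (- 2), v 1} = (\<not> k)" "c {v (- 1), v 2} = (\<not> k)"
    by (auto simp: insert_commute)
  obtain m where m: "L = 2 * m"
    using even_L by blast
  \<comment> \<open>The walk is to start and end next to the blue vertex at \<open>2 * t\<close>.
    Since position 0 is red, \<open>t\<close> is not 0 and both stretches of odd positions are
    nonempty; without blue vertices \<open>t = 1\<close> serves.\<close>
  obtain t where t: "0 < t" "t < m" "\<not> red (2 * int t) \<or> (\<forall>i. red i)"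
  proof (cases "\<forall>i. red i")
    case True
    then show ?thesis
      using that[of 1] six_le m by auto
  next
    case False
    then obtain i where i: "\<not> red i"
      by blast
    then have "even i"
      using assms(1) by blast
    then have "even (i mod int L)"
      using even_L by (simp add: dvd_mod)
    then obtain j where j: "i mod int L = 2 * j"
      by blast
    have "0 \<le> i mod int L" "i mod int L < int L"
      using two_le by auto
    moreover have "\<not> red (2 * j)"
      using i v_mod[of i] red_cong j by metis
    moreover have "j \<noteq> 0"
      using \<open>\<not> red (2 * j)\<close> assms(2) by auto
    ultimately show ?thesis
      using that[of "nat j"] j m by auto
  qed
  \<comment> \<open>First come the odd positions from \<open>2 * t + 1\<close> to -1, then by a
    cross edge the even ones from 2 to -2, then by the other cross edge the odd ones from 1 to
    \<open>2 * t - 1\<close>. Only \<open>v 0\<close> is missed, a blue cycle by convention.\<close>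
  let ?w = "arc v 2 (2 * int t + 1) (m - t) @ arc v 2 2 (m - 1) @ arc v 2 1 t"
  have odds: "arc v 2 1 m = arc v 2 1 t @ arc v 2 (2 * int t + 1) (m - t)"
    using arc_append[of v 2 1 t "m - t"] t by (simp add: algebra_simps)
  have evens: "arc v 2 0 m = v 0 # arc v 2 2 (m - 1)"
    using arc_Suc[of v 2 0 "m - 1"] t by simp
  have sets: "set (arc v 2 1 m) = v ` {i. odd i}" "set (arc v 2 0 m) = v ` {i. even i}"
    using set_stride[OF m] by auto
  have dist: "distinct (arc v 2 1 m)" "distinct (arc v 2 0 m)"
    using distinct_stride m by auto
  have par: "v ` {i. odd i} \<inter> v ` {i. even i} = {}"
    using parity_disjoint[OF even_L] by fastforce
  have dw: "distinct ?w"
    using dist sets par unfolding odds evens by auto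
  have set_w: "set ?w = range v - {v 0}"
  proof -
    have "set ?w = v ` {i. odd i} \<union> (v ` {i. even i} - {v 0})"
      using sets dist unfolding odds evens by auto
    moreover have "v 0 \<notin> v ` {i. odd i}"
      using par by auto
    ultimately show ?thesis
      by auto
  qed
  have ends: "v (2 * int t + 1 + 2 * (int (m - t) - 1)) = v (- 1)" "v (2 + 2 * (int (m - 1) - 1)) = v (- 2)"
    using t m by (auto intro!: eqI)
  have "skip (v (- 1)) (v 2)" "skip (v (- 2)) (v 1)"
    using cross by (auto simp: skip_def)
  then have sw: "successively skip ?w"
    using t m six_le ends by (simp add: successively_append_iff successively_skip_stride)
  have "hd ?w = v (2 * int t + 1)" "last ?w = v (2 * int t - 1)"
    using t by (auto simp: algebra_simps)
  then obtain T where "red_ends T" "set T = set ?w"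
    using link[OF sw dw] t by auto
  moreover have "spans_cycle c k (range v - set ?w)"
    using set_w by (simp add: spans_cycle_def Diff_Diff_Int)
  ultimately show False
    using no_red_ends[of T] set_w by auto
qed

text \<open>One of \<open>v 0\<close>, \<open>v 1\<close> is a red neighbour of \<open>hd R\<close>;
  the other closes the cycle at \<open>y\<close>, and \<open>x\<close> links the two.\<close>

lemma pair_cycle:
  assumes "red 0" "red 1" "mono_path c (\<not> k) R" "R \<noteq> []" "set R \<subseteq> set P - {x}" "last R = y"
    and "c {hd R, v 0} = (\<not> k) \<or> c {hd R, v 1} = (\<not> k)"
  shows "spans_cycle c (\<not> k) ({x, v 0, v 1} \<union> set R)"
proof -
  have neq: "v 0 \<noteq> v 1"
    using neqI[of 0 1] two_le by simp
  have out: "v 0 \<notin> set R" "v 1 \<notin> set R" "x \<notin> set R"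
    using assms(5) off_P by auto
  show ?thesis
    using assms(7)
  proof
    assume "c {hd R, v 0} = (\<not> k)"
    then have "closed_path c (\<not> k) ([v 1, x, v 0] @ R)"
      using assms neq out off_cycle
      by (auto simp: closed_path_def mono_path_append mono_path_Cons red_def insert_commute)
    then show ?thesis
      by (rule spans_cycleI) auto
  next
    assume "c {hd R, v 1} = (\<not> k)"
    then have "closed_path c (\<not> k) ([v 0, x, v 1] @ R)"
      using assms neq out off_cycle
      by (auto simp: closed_path_def mono_path_append mono_path_Cons red_def insert_commute)
    then show ?thesis
      by (rule spans_cycleI) auto
  qed
qed

lemma last_rest: "v (2 + (int (L - 2) - 1)) = v (- 1)"
  by (rule eqI) (use two_le in auto)

text \<open>Otherwise a blue edge closes the cycle without \<open>v 0\<close> and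
  \<open>v 1\<close>, while these two vertices form a red cycle with all of
  \<open>P\<close>.\<close>

lemma x1_pair:
  assumes "red 0" "red 1" "c {x1, v 0} = (\<not> k) \<or> c {x1, v 1} = (\<not> k)"
  shows "c {v 2, v (- 1)} = (\<not> k)"
proof (rule ccontr)
  assume "c {v 2, v (- 1)} \<noteq> (\<not> k)"
  then have "closed_path c k (arc v 1 2 (L - 2))"
    using four_le mono_path_arc[of "L - 2" 2] last_rest by (auto simp: closed_path_def insert_commute)
  then have 1: "spans_cycle c k (range v - {v 0, v 1})"
    by (rule spans_cycleI) (simp add: set_arc_L2[of 2 0])
  have 2: "spans_cycle c (\<not> k) ({x, v 0, v 1} \<union> set (x1 # Q))"
    using assms P_distinct P_path Q_ne set_P last_Q by (intro pair_cycle) (auto simp: mono_path_Cons)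
  show False
    by (rule solve[OF 1 2]) (use V_eq off_cycle in auto)
qed

text \<open>Here \<open>x1\<close> closes the blue arc from \<open>v 2\<close> to
  \<open>v (- 1)\<close>; a red edge from \<open>x2\<close> to \<open>v 0\<close> or
  \<open>v 1\<close> would give a red cycle on everything else.\<close>

lemma x2_pair:
  assumes "red 0" "red 1" "c {x1, v 2} = k" "c {x1, v (- 1)} = k"
  shows "c {x2, v 0} = k \<and> c {x2, v 1} = k"
proof (rule ccontr)
  assume "\<not> ?thesis"
  then have 2: "spans_cycle c (\<not> k) ({x, v 0, v 1} \<union> set Q)"
    using assms P_distinct P_path Q_ne set_P last_Q by (intro pair_cycle) auto
  have "closed_path c k (x1 # arc v 1 2 (L - 2))"
    using four_le mono_path_arc[of "L - 2" 2] last_rest set_arc_L2[of 2 0] off_cycle assms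
    by (auto simp: closed_path_def mono_path_Cons insert_commute)
  then have 1: "spans_cycle c k (insert x1 (range v - {v 0, v 1}))"
    by (rule spans_cycleI) (simp add: set_arc_L2[of 2 0])
  show False
    by (rule solve[OF 1 2]) (use V_eq off_cycle P_distinct in auto)
qed

text \<open>If this edge were red, a red Hamiltonian cycle would run through the even positions from
  \<open>v 2\<close> to \<open>v 0\<close>, then \<open>x\<close>, the odd positions, and the path
  backwards from \<open>y\<close> to \<open>x1\<close>.\<close>

lemma x1_second:
  assumes odd: "\<And>i. odd i \<Longrightarrow> red i" and "red 0"
  shows "c {x1, v 2} = k"
proof (rule ccontr)
  assume "c {x1, v 2} \<noteq> k"
  obtain m where m: "L = 2 * m"
    using even_L by blast
  obtain g where g: "\<not> red g \<or> (\<forall>i. red i)" "even g"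
    using odd by (metis even_zero)
  obtain T where T: "red_ends T" "set T = v ` {i. odd (i - g)}"
    using parity_path[OF m g(1)] by blast
  have set_T: "set T = v ` {i. odd i}"
    using T(2) g(2) by simp
  have "c {v (2 + 2 * int j), v (2 + 2 * int j + 2)} = (\<not> k)" for j
    using red_skip[of "2 + 2 * int j + 1"] odd by (simp add: algebra_simps)
  then have E: "mono_path c (\<not> k) (arc v 2 2 m)"
    using distinct_stride m by (simp add: mono_path_def successively_arc)
  have set_E: "set (arc v 2 2 m) = v ` {i. even i}"
    using set_stride[OF m, of 2] by simp
  have "0 < m"
    using m two_le by simp
  have last_E: "last (arc v 2 2 m) = v 0"
  proof -
    have "v (2 + 2 * (int m - 1)) = v 0"
      by (rule eqI) (use m in auto)
    then show ?thesis
      using \<open>0 < m\<close> by simp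
  qed
  define R where "R = rev (x1 # Q)"
  have "mono_path c (\<not> k) (x1 # Q)"
    using P_path P_distinct Q_ne by (simp add: mono_path_Cons)
  then have R: "mono_path c (\<not> k) R"
    unfolding R_def by (subst mono_path_rev)
  have R_ends: "R \<noteq> []" "hd R = y" "last R = x1" "set R = insert x1 (set Q)"
    using Q_ne last_Q by (auto simp: R_def hd_rev hd_append)
  have par: "v ` {i. odd i} \<inter> v ` {i. even i} = {}"
    using parity_disjoint[OF even_L] by fastforce
  have T_ends: "T \<noteq> []" "mono_path c (\<not> k) T" "c {x, hd T} = (\<not> k)" "c {last T, y} = (\<not> k)"
    using T(1) by (auto simp: red_ends_def red_def insert_commute)
  have off: "x \<notin> set T" "set T \<inter> set R = {}" "x \<notin> set R"
    using set_T R_ends off_cycle P_distinct by auto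
  have "mono_path c (\<not> k) (T @ R)"
    using T_ends R R_ends off by (simp add: mono_path_append)
  then have xTR: "mono_path c (\<not> k) (x # T @ R)"
    using T_ends off by (simp add: mono_path_Cons)
  have "c {v 0, x} = (\<not> k)"
    using assms(2) by (simp add: red_def insert_commute)
  then have "mono_path c (\<not> k) (arc v 2 2 m @ x # T @ R)"
    using E xTR last_E set_E set_T R_ends(4) par off_cycle unfolding mono_path_append[of _ _ "arc v 2 2 m"]
    by auto
  then have "closed_path c (\<not> k) (arc v 2 2 m @ x # T @ R)"
    using \<open>c {x1, v 2} \<noteq> k\<close> \<open>0 < m\<close> R_ends by (simp add: closed_path_def hd_append)
  moreover have "set (arc v 2 2 m @ x # T @ R) = V"
    using set_E set_T R_ends(4) V_eq by auto
  ultimately have "spans_cycle c (\<not> k) V"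
    by (rule spans_cycleI)
  then show False
    using solve[of "{}" V] by simp
qed

text \<open>Exchanging \<open>v (- 1)\<close> with \<open>x1\<close> yields another extremal pair,
  whose path runs from \<open>x\<close> to \<open>x2\<close>. As \<open>x2\<close> is joined in blue
  to \<open>v 0\<close> and \<open>v 1\<close>, this pair has blue vertices of both parities,
  against \<open>red_parity\<close>.\<close>

lemma no_red_aux:
  assumes odd: "\<And>i. odd i \<Longrightarrow> red i" and "red 0" and "c {x1, v (- 1)} = k"
  shows False
proof -
  interpret r: extremal c k L "\<lambda>i. v (- i)" P V
    by (rule reflect_extremal)
  have r_red: "r.red i = red (- i)" for i
    by (simp add: r.red_def red_def)
  have x1_2: "c {x1, v 2} = k"
    using x1_second odd assms(2) by blast
  have x1_m2: "c {x1, v (- 2)} = k"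
    using r.x1_second odd assms(2) by (simp add: r_red)
  have "red 1"
    using odd by simp
  \<comment> \<open>A red edge here would make both cross edges red, by \<open>x1_pair\<close> and
    its mirror image, against \<open>cross_edges\<close>.\<close>
  have x1_0: "c {x1, v 0} = k"
  proof (rule ccontr)
    assume "c {x1, v 0} \<noteq> k"
    then have "c {v 2, v (- 1)} = (\<not> k)" "c {v (- 2), v 1} = (\<not> k)"
      using x1_pair r.x1_pair assms(2) \<open>red 1\<close> odd[of "- 1"] by (auto simp: r_red)
    then show False
      using cross_edges[OF odd assms(2)] by auto
  qed
  have x2: "c {x2, v 0} = k" "c {x2, v 1} = k"
    using x2_pair[OF assms(2) \<open>red 1\<close> x1_2 assms(3)] by auto
  define v' where "v' = (\<lambda>i. if v i = v (- 1) then x1 else v i)"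
  have neq: "v 0 \<noteq> v (- 1)" "v 1 \<noteq> v (- 1)"
    using neqI six_le by auto
  interpret s: int_cycle c k L v'
    unfolding v'_def by (rule replace) (use off_cycle x1_0 x1_m2 in \<open>auto simp: insert_commute\<close>)
  let ?P = "x # v (- 1) # rev Q"
  have P': "mono_path c (\<not> k) ?P"
    using P_path P_distinct off_cycle odd[of "- 1"] Q_ne last_Q
    by (auto simp: mono_path_Cons red_def insert_commute hd_rev)
  have range_v': "range v' = insert x1 (range v - {v (- 1)})"
    by (auto simp: v'_def)
  interpret s: extremal c k L v' ?P V
    by unfold_locales (use P' range_v' P_distinct off_cycle V_eq maximal unsolved in auto)
  have ends: "hd ?P = x" "last ?P = x2"
    using Q_ne by (auto simp: last_rev)
  have "v' 0 = v 0" "v' 1 = v 1"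
    using neq by (auto simp: v'_def)
  then have "\<not> s.red 0" "\<not> s.red 1"
    using x2 unfolding s.red_def ends by auto
  then show False
    using s.red_parity even_zero odd_one by blast
qed

text \<open>Red edges from \<open>x1\<close> to both \<open>v 1\<close> and \<open>v (- 1)\<close>
  would make both cross edges red; so one of them is blue, and up to reflection
  \<open>no_red_aux\<close> applies.\<close>

lemma no_red:
  assumes odd: "\<And>i. odd i \<Longrightarrow> red i" and "red 0"
  shows False
proof -
  interpret r: extremal c k L "\<lambda>i. v (- i)" P V
    by (rule reflect_extremal)
  have r_red: "r.red i = red (- i)" for i
    by (simp add: r.red_def red_def)
  have "c {x1, v (- 1)} = k \<or> c {x1, v 1} = k"
  proof (rule ccontr)
    assume "\<not> ?thesis"
    then have "c {v 2, v (- 1)} = (\<not> k)" "c {v (- 2), v 1} = (\<not> k)"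
      using x1_pair r.x1_pair assms(2) odd[of 1] odd[of "- 1"] by (auto simp: r_red)
    then show False
      using cross_edges[OF odd assms(2)] by auto
  qed
  then show False
    using no_red_aux[OF odd assms(2)] r.no_red_aux odd assms(2) by (auto simp: r_red)
qed

section \<open>Even vertices red, odd vertices blue\<close>

lemma same_side_aux:
  assumes even: "\<And>i. even i \<Longrightarrow> red i" and "c {x, v (- 1)} = k" "c {x, v 1} = k"
  shows "c {x1, v 0} = k" "even j \<Longrightarrow> v j \<noteq> v 0 \<Longrightarrow> c {x1, v j} = (\<not> k)"
proof -
  \<comment> \<open>Both neighbours of \<open>v 0\<close> are joined to \<open>x\<close> in blue, so
    \<open>v 0\<close> and \<open>x\<close> can be exchanged; the new path runs from
    \<open>v 0\<close> through \<open>y\<close> back to \<open>x1\<close>. The facts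
    \<open>end_edge\<close> and \<open>red_parity\<close> of the new pair give the two
    claims.\<close>
  define v' where "v' = (\<lambda>i. if v i = v 0 then x else v i)"
  interpret s: int_cycle c k L v'
    unfolding v'_def by (rule replace) (use off_cycle assms in \<open>auto simp: insert_commute\<close>)
  let ?P = "v 0 # rev (x1 # Q)"
  have "mono_path c (\<not> k) (x1 # Q)"
    using P_path P_distinct Q_ne by (simp add: mono_path_Cons)
  then have P': "mono_path c (\<not> k) ?P"
    using off_cycle even[of 0] Q_ne last_Q unfolding mono_path_Cons[of _ _ "v 0"] mono_path_rev
    by (auto simp: red_def insert_commute hd_append hd_rev)
  have range_v': "range v' = insert x (range v - {v 0})"
    by (auto simp: v'_def)
  interpret s: extremal c k L v' ?P V
    by unfold_locales (use P' range_v' P_distinct off_cycle V_eq maximal unsolved in auto)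
  have ends: "hd ?P = v 0" "last ?P = x1"
    by auto
  show "c {x1, v 0} = k"
    using s.end_edge unfolding ends by (simp add: insert_commute)
  have "v' 1 = v 1"
    using neqI[of 1 0] two_le by (auto simp: v'_def)
  \<comment> \<open>Now \<open>v 0\<close> is an end of the path, and its old cycle edge makes
    \<open>v 1\<close> blue; so the even class is the red one.\<close>
  then have "\<not> s.red 1"
    using edge[of 0] unfolding s.red_def ends by auto
  then have "\<forall>i. even i \<longrightarrow> s.red i"
    using s.red_parity odd_one by blast
  then show "c {x1, v j} = (\<not> k)" if "even j" "v j \<noteq> v 0"
  proof -
    have "s.red j"
      using \<open>\<forall>i. even i \<longrightarrow> s.red i\<close> that(1) by blast
    then show ?thesis
      unfolding s.red_def ends using that(2) by (simp add: v'_def)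
  qed
qed

lemma same_side:
  assumes even: "\<And>i. even i \<Longrightarrow> red i" and "even i" "c {x, v (i - 1)} = k" "c {x, v (i + 1)} = k"
  shows "c {x1, v i} = k" "even j \<Longrightarrow> v j \<noteq> v i \<Longrightarrow> c {x1, v j} = (\<not> k)"
proof -
  interpret s: extremal c k L "\<lambda>n. v (n + i)" P V
    by (rule shift_extremal)
  have "s.red n" if "even n" for n
    using that even[of "n + i"] assms(2) by (simp add: s.red_def red_def)
  note * = s.same_side_aux[OF this]
  show "c {x1, v i} = k"
    using *(1) assms by (simp add: add.commute)
  show "c {x1, v j} = (\<not> k)" if "even j" "v j \<noteq> v i"
    using *(2)[of "j - i"] assms that by (simp add: add.commute)
qed

lemma butlast_tl_P: "mono_path c (\<not> k) (butlast (x1 # Q))" "set (butlast (x1 # Q)) = insert x1 (set Q) - {y}"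
  "hd (butlast (x1 # Q)) = x1" "y \<in> set Q"
proof -
  have *: "mono_path c (\<not> k) (x1 # Q)"
    using P_path P_distinct Q_ne by (simp add: mono_path_Cons)
  show "mono_path c (\<not> k) (butlast (x1 # Q))"
    using * by (rule mono_path_butlast)
  obtain Q' where Q: "Q = Q' @ [y]"
    using Q_ne last_Q by (metis append_butlast_last_id)
  have "distinct Q"
    using P_path by (simp add: mono_path_def)
  then show "set (butlast (x1 # Q)) = insert x1 (set Q) - {y}"
    using P_distinct unfolding Q by (auto simp: butlast_append)
  show "hd (butlast (x1 # Q)) = x1"
    using Q_ne by simp
  show "y \<in> set Q"
    unfolding Q by simp
qed

text \<open>Replacing \<open>v 0\<close> by the blue edge \<open>xy\<close> lengthens the cycle; if
  \<open>x1\<close> were joined to \<open>v 0\<close> in red, the rest of \<open>P\<close> with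
  \<open>v 0\<close> in front would still be a red path.\<close>

lemma opposite_sides_aux:
  assumes "c {x, v (- 1)} = k" "c {y, v 1} = k"
  shows "c {x1, v 0} = k"
proof (rule ccontr)
  assume ne: "c {x1, v 0} \<noteq> k"
  have last: "v (1 + (int (L - 1) - 1)) = v (- 1)"
    by (rule eqI) (use two_le in auto)
  have "closed_path c k (x # y # arc v 1 1 (L - 1))"
    using four_le mono_path_arc[of "L - 1" 1] last set_arc_L1[of 1 0] off_cycle assms end_edge P_distinct
    by (auto simp: closed_path_def mono_path_Cons insert_commute)
  moreover have "mono_path c (\<not> k) (v 0 # butlast (x1 # Q))"
    using butlast_tl_P off_cycle ne unfolding mono_path_Cons[of _ _ "v 0"] by (auto simp: insert_commute)
  ultimately have "length (x # y # arc v 1 1 (L - 1)) \<le> L"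
    by (rule maximal) (use set_arc_L1[of 1 0] butlast_tl_P off_cycle P_distinct V_eq in auto)
  then show False
    using two_le by simp
qed

lemma opposite_sides:
  assumes "c {x, v (i - 1)} = k \<and> c {y, v (i + 1)} = k \<or> c {y, v (i - 1)} = k \<and> c {x, v (i + 1)} = k"
  shows "c {x1, v i} = k"
proof -
  interpret s: extremal c k L "\<lambda>n. v (n + i)" P V
    by (rule shift_extremal)
  interpret t: extremal c k L "\<lambda>n. v (- n + i)" P V
    by (rule s.reflect_extremal)
  show ?thesis
    using s.opposite_sides_aux t.opposite_sides_aux assms by (auto simp: add.commute)
qed

text \<open>The detour \<open>x\<close>, \<open>y\<close>, \<open>v 1\<close>, \<open>v 0\<close>,
  \<open>x1\<close>, \<open>v 2\<close> takes three vertices of \<open>P\<close> into the blue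
  cycle, and \<open>Q\<close> without \<open>y\<close> remains a red path.\<close>

lemma no_detour:
  assumes "c {x, v (- 1)} = k" "c {y, v 1} = k" "c {x1, v 0} = k" "c {x1, v 2} = k"
  shows False
proof -
  have neq: "v 0 \<noteq> v 1"
    using neqI[of 0 1] two_le by simp
  have "closed_path c k ([x, y, v 1, v 0, x1] @ arc v 1 2 (L - 2))"
    using four_le mono_path_arc[of "L - 2" 2] last_rest set_arc_L2[of 2 0] off_cycle assms end_edge
      P_distinct neq edge[of 0] unfolding closed_path_def mono_path_append
    by (auto simp: mono_path_Cons insert_commute)
  moreover have "mono_path c (\<not> k) (butlast Q)"
    by (rule mono_path_butlast) (rule P_path)
  moreover have "set (butlast Q) = set Q - {y}"
    using P_path(1) append_butlast_last_id[OF Q_ne] last_Q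
    by (metis Diff_insert_absorb List.set_insert Un_insert_right distinct_append insert_is_Un
        disjoint_insert(1) list.simps(15) mono_path_def set_append sup_bot_right list.set(1))
  ultimately have "length ([x, y, v 1, v 0, x1] @ arc v 1 2 (L - 2)) \<le> L"
    by (intro maximal) (use set_arc_L2[of 2 0] butlast_tl_P(4) off_cycle P_distinct V_eq in auto)
  then show False
    using two_le by simp
qed

text \<open>Each odd vertex is joined in blue to \<open>x\<close> (\<open>X\<close>) or to
  \<open>y\<close> (\<open>Y\<close>). If both neighbours of an even position satisfy
  \<open>X\<close>, then \<open>x1\<close> is blue there and red at all other even positions; two
  further even positions must then have \<open>Y\<close> on both sides, which makes
  \<open>y1\<close> blue and red at once. Hence 0, 2 and 4 are mixed, and \<open>no_detour\<close>
  applies.\<close>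

lemma no_blue:
  assumes even: "\<And>i. even i \<Longrightarrow> red i" and odd: "\<And>i. odd i \<Longrightarrow> \<not> red i"
  shows False
proof -
  interpret r: extremal c k L v "rev P" V
    by (rule rev_extremal)
  have ends: "hd (rev P) = y" "last (rev P) = x"
    using length_P by (auto simp: hd_rev last_rev)
  define y1 where "y1 = rev P ! 1"
  have r_red: "r.red i = red i" for i
    by (auto simp: r.red_def red_def ends)
  define X where "X i \<longleftrightarrow> c {x, v i} = k" for i
  define Y where "Y i \<longleftrightarrow> c {y, v i} = k" for i
  have XY: "X i \<or> Y i" if "odd i" for i
    using odd[OF that] by (auto simp: red_def X_def Y_def)
  have xx: "c {x1, v i} = k" "even j \<Longrightarrow> v j \<noteq> v i \<Longrightarrow> c {x1, v j} = (\<not> k)"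
    if "even i" "X (i - 1)" "X (i + 1)" for i j
    using same_side(1)[OF even, of i] same_side(2)[OF even, of i j] that by (auto simp: X_def)
  have yy: "c {y1, v i} = k" "even j \<Longrightarrow> v j \<noteq> v i \<Longrightarrow> c {y1, v j} = (\<not> k)"
    if "even i" "Y (i - 1)" "Y (i + 1)" for i j
    using r.same_side(1)[of i] r.same_side(2)[of i j] even that by (auto simp: Y_def r_red ends y1_def)
  have xy: "c {x1, v i} = k" "c {y1, v i} = k"
    if "X (i - 1) \<and> Y (i + 1) \<or> Y (i - 1) \<and> X (i + 1)" for i
    using opposite_sides[of i] r.opposite_sides[of i] that by (auto simp: X_def Y_def ends y1_def)
  have types: "X (i - 1) \<and> X (i + 1) \<or> Y (i - 1) \<and> Y (i + 1) \<or>
      (X (i - 1) \<and> Y (i + 1) \<or> Y (i - 1) \<and> X (i + 1))" if "even i" for i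
    using XY[of "i - 1"] XY[of "i + 1"] that by auto
  have neq: "v 0 \<noteq> v 2" "v 0 \<noteq> v 4" "v 2 \<noteq> v 4"
    using neqI six_le by auto
  have not_same: "\<not> (X (i - 1) \<and> X (i + 1)) \<and> \<not> (Y (i - 1) \<and> Y (i + 1))" 
    if i: "i \<in> {0, 2, 4}" for i
  proof -
    obtain j l where jl: "even i" "even j" "even l" "v i \<noteq> v j" "v i \<noteq> v l" "v j \<noteq> v l"
    proof -
      consider "i = 0" | "i = 2" | "i = 4"
        using i by auto
      then show ?thesis
        by cases (use that[of 2 4] that[of 0 4] that[of 0 2] neq in auto)
    qed
    have k: "k \<noteq> (\<not> k)"
      by simp
    have "\<not> (X (i - 1) \<and> X (i + 1))"
    proof
      assume X: "X (i - 1) \<and> X (i + 1)"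
      have "c {x1, v j} = (\<not> k)" "c {x1, v l} = (\<not> k)"
        using xx(2) X jl by metis+
      then have "Y (j - 1) \<and> Y (j + 1)" "Y (l - 1) \<and> Y (l + 1)"
        using types[of j] types[of l] xx(1) xy(1) jl k by metis+
      then show False
        using yy jl k by metis
    qed
    moreover have "\<not> (Y (i - 1) \<and> Y (i + 1))"
    proof
      assume Y: "Y (i - 1) \<and> Y (i + 1)"
      have "c {y1, v j} = (\<not> k)" "c {y1, v l} = (\<not> k)"
        using yy(2) Y jl by metis+
      then have "X (j - 1) \<and> X (j + 1)" "X (l - 1) \<and> X (l + 1)"
        using types[of j] types[of l] yy(1) xy(2) jl k by metis+
      then show False
        using xx jl k by metis
    qed
    ultimately show ?thesis
      by blast
  qed
  have opp: "X (i - 1) \<and> Y (i + 1) \<or> Y (i - 1) \<and> X (i + 1)" if "i \<in> {0, 2}" for i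
    using types[of i] not_same[of i] that by auto
  have x1: "c {x1, v 0} = k" "c {x1, v 2} = k"
    using xy(1)[OF opp] by auto
  have y1: "c {y1, v 0} = k" "c {y1, v 2} = k"
    using xy(2)[OF opp] by auto
  show False
    using opp[of 0] no_detour r.no_detour x1 y1 by (auto simp: X_def Y_def ends y1_def)
qed

lemma not_odd_red:
  assumes odd: "\<And>i. odd i \<Longrightarrow> red i"
  shows False
proof (cases "\<exists>i. even i \<and> red i")
  case True
  then obtain i where i: "even i" "red i"
    by blast
  interpret s: extremal c k L "\<lambda>n. v (n + i)" P V
    by (rule shift_extremal)
  have "s.red n = red (n + i)" for n
    by (simp add: s.red_def red_def)
  then show False
    using s.no_red odd i by auto
next
  case False
  interpret s: extremal c k L "\<lambda>n. v (n + 1)" P V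
    by (rule shift_extremal)
  have "s.red n = red (n + 1)" for n
    by (simp add: s.red_def red_def)
  then show False
    using s.no_blue odd False by auto
qed

lemma contradiction: False
proof (cases "\<forall>i. odd i \<longrightarrow> red i")
  case True
  then show False
    using not_odd_red by blast
next
  case False
  then have even: "red i" if "even i" for i
    using red_parity False that by metis
  interpret s: extremal c k L "\<lambda>n. v (n + 1)" P V
    by (rule shift_extremal)
  have "s.red n = red (n + 1)" for n
    by (simp add: s.red_def red_def)
  then show False
    using s.not_odd_red even by auto
qed

end

section \<open>Two colours\<close>

text \<open>The list \<open>p @ w # q\<close> is a path that changes colour at most once, at the
  pivot \<open>w\<close>; either side may be empty.\<close>

definition split_path :: "('a set \<Rightarrow> 'k) \<Rightarrow> 'k \<Rightarrow> 'k \<Rightarrow> 'a list \<Rightarrow> 'a \<Rightarrow> 'a list \<Rightarrow> bool" where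
  "split_path c a b p w q \<longleftrightarrow>
     mono_path c a (p @ [w]) \<and> mono_path c b (w # q) \<and> set p \<inter> set q = {}"

lemma split_path_rev: "split_path c a b p w q \<Longrightarrow> split_path c b a (rev q) w (rev p)"
  using mono_path_rev[of c b "w # q"] mono_path_rev[of c a "p @ [w]"]
  by (auto simp: split_path_def simp del: mono_path_rev)

lemma split_path_mono:
  assumes "mono_path c a xs" "xs \<noteq> []"
  obtains p w where "split_path c a b p w []" "set (p @ [w]) = set xs"
  using that[of "butlast xs" "last xs"] assms by (auto simp: split_path_def mono_path_Cons)

text \<open>The last vertex is moved to the front: \<open>v\<close>, this vertex and the old head
  follow each other in colour \<open>a\<close>. If \<open>q\<close> is empty, \<open>p @ [w]\<close>
  closes up in colour \<open>a\<close> and is reopened at \<open>w\<close>.\<close>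

lemma split_path_extend:
  assumes pwq: "split_path c a b p w q" and v: "v \<notin> set (p @ w # q)"
    and "c {v, last (w # q)} = a" "hd (p @ [w]) \<noteq> last (w # q) \<Longrightarrow> c {hd (p @ [w]), last (w # q)} = a"
  shows "\<exists>p' w' q'. split_path c a b p' w' q' \<and> set (p' @ w' # q') = insert v (set (p @ w # q))"
proof (cases q rule: rev_cases)
  case Nil
  have "w \<notin> set p" "mono_path c a p"
    using pwq by (auto simp: split_path_def mono_path_append)
  moreover have "p \<noteq> [] \<Longrightarrow> c {w, hd p} = a"
    using assms(4) Nil \<open>w \<notin> set p\<close> by (cases p) (auto simp: insert_commute)
  ultimately have "mono_path c a (v # w # p)"
    using assms(3) v Nil by (auto simp: mono_path_Cons)
  then obtain p' w' where "split_path c a b p' w' []" "set (p' @ [w']) = set (v # w # p)"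
    by (rule split_path_mono) auto
  then show ?thesis
    using Nil by (intro exI[of _ p'] exI[of _ w'] exI[of _ "[]"]) auto
next
  case (snoc q' t)
  have t: "t \<notin> set (p @ [w])" "mono_path c b (w # q')" "t \<noteq> v"
    using pwq v snoc mono_path_append[of c b "w # q'" "[t]"] by (auto simp: split_path_def)
  have "hd (p @ [w]) \<in> set (p @ [w])"
    by (rule hd_in_set) simp
  then have "c {t, hd (p @ [w])} = a"
    using assms(4) t(1) snoc by (auto simp: insert_commute)
  then have "mono_path c a ((v # t # p) @ [w])"
    using pwq assms(3) v t snoc by (auto simp: split_path_def mono_path_Cons)
  moreover have "set (v # t # p) \<inter> set q' = {}"
    using pwq v t snoc by (auto simp: split_path_def mono_path_Cons mono_path_append)
  ultimately show ?thesis
    using t(2) snoc by (intro exI[of _ "v # t # p"] exI[of _ w] exI[of _ q']) (auto simp: split_path_def)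
qed

text \<open>By induction: a new vertex that fits neither end has colour \<open>b\<close> to the head
  and \<open>a\<close> to the last vertex, and the colour of the edge between the two ends decides
  which of them changes sides.\<close>

lemma ex_split_path:
  fixes c :: "'a set \<Rightarrow> 'k"
  assumes "finite V" "V \<noteq> {}" "\<And>u w. u \<in> V \<Longrightarrow> w \<in> V \<Longrightarrow> u \<noteq> w \<Longrightarrow> c {u, w} \<in> {a, b}"
  shows "\<exists>p w q. split_path c a b p w q \<and> set (p @ w # q) = V"
  using assms
proof (induction V rule: finite_ne_induct)
  case (singleton w)
  show ?case
    by (rule exI[of _ "[]"], rule exI[of _ w], rule exI[of _ "[]"]) (auto simp: split_path_def mono_path_Cons)
next
  case (insert v V)
  obtain p w q where IH: "split_path c a b p w q" "set (p @ w # q) = V"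
    using insert.IH insert.prems by (metis insertCI)
  define s t where "s = hd (p @ [w])" and "t = last (w # q)"
  have "s \<in> set (p @ [w])" "t \<in> set (w # q)"
    unfolding s_def t_def by (rule hd_in_set last_in_set; simp)+
  then have st: "s \<in> V" "t \<in> V"
    using IH(2) by auto
  have v: "v \<notin> set (p @ w # q)"
    using IH(2) insert.hyps by simp
  have ok: "c {v, s} \<in> {a, b}" "c {v, t} \<in> {a, b}" "s \<noteq> t \<Longrightarrow> c {s, t} \<in> {a, b}"
    using st insert.hyps insert.prems by auto
  consider "c {v, s} = a" | "c {v, t} = b" | "c {v, s} = b" "c {v, t} = a" "s \<noteq> t"
    using ok by auto
  then show ?case
  proof cases
    case 1
    then have "split_path c a b (v # p) w q"
      using IH(1) v by (auto simp: split_path_def mono_path_Cons s_def)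
    then show ?thesis
      using IH(2) by (intro exI[of _ "v # p"] exI[of _ w] exI[of _ q]) auto
  next
    case 2
    then have "mono_path c b ((w # q) @ [v])"
      using IH(1) v unfolding mono_path_append[of c b "w # q"]
      by (auto simp: split_path_def t_def insert_commute mono_path_Cons)
    then have "split_path c a b p w (q @ [v])"
      using IH(1) v by (auto simp: split_path_def)
    then show ?thesis
      using IH(2) by (intro exI[of _ p] exI[of _ w] exI[of _ "q @ [v]"]) auto
  next
    case 3
    show ?thesis
    proof (cases "c {s, t} = a")
      case True
      then show ?thesis
        using split_path_extend[OF IH(1) v] 3 IH(2) unfolding s_def t_def by auto
    next
      case False
      then have st_b: "c {t, s} = b"
        using ok(3) 3 by (auto simp: insert_commute)
      have eqs: "last (w # rev p) = s" "hd (rev q @ [w]) = t"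
        by (auto simp: s_def t_def last_rev hd_rev hd_append)
      have "v \<notin> set (rev q @ w # rev p)"
        using v by auto
      from split_path_extend[OF split_path_rev[OF IH(1)] this, unfolded eqs]
      obtain p' w' q' where "split_path c b a p' w' q'" "set (p' @ w' # q') = insert v (set (rev q @ w # rev p))"
        using 3 st_b by blast
      then show ?thesis
        using split_path_rev[of c b a p' w' q'] IH(2)
        by (intro exI[of _ "rev q'"] exI[of _ w'] exI[of _ "rev p'"]) auto
    qed
  qed
qed

text \<open>If the edge between the ends of a path with one colour change has colour
  \<open>a\<close>, it attaches the last vertex \<open>t\<close> to the \<open>a\<close>-side; the
  colour of \<open>{w, t}\<close> decides whether this longer \<open>a\<close>-path or the other
  side \<open>w # q\<close> closes to a cycle.\<close>

lemma ex_cycle_and_path: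
  fixes c :: "'a set \<Rightarrow> bool"
  assumes "finite V" "2 \<le> card V"
  obtains k D R where "closed_path c k D" "mono_path c (\<not> k) R" "set D \<inter> set R = {}" "set D \<union> set R = V"
    "2 \<le> length D"
proof -
  have half: "\<exists>k D R. closed_path c k D \<and> mono_path c (\<not> k) R \<and> set D \<inter> set R = {} \<and> set D \<union> set R = V \<and> 2 \<le> length D"
    if pwq: "split_path c a (\<not> a) p w q" "set (p @ w # q) = V" and closing: "c {hd (p @ [w]), last (w # q)} = a"
    for a p w q
  proof (cases q rule: rev_cases)
    case Nil
    have "distinct (p @ [w])"
      using pwq(1) by (auto simp: split_path_def mono_path_def)
    then have "2 \<le> length (p @ [w])"
      using assms(2) pwq(2) Nil distinct_card[of "p @ [w]"] by simp
    moreover have "closed_path c a (p @ [w])"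
      using pwq(1) closing Nil by (auto simp: split_path_def closed_path_def insert_commute)
    ultimately show ?thesis
      using pwq(2) Nil by (intro exI[of _ a] exI[of _ "p @ [w]"] exI[of _ "[]"]) auto
  next
    case (snoc q' t)
    have q: "mono_path c (\<not> a) q'" "t \<notin> set (p @ [w])" "t \<notin> set q'" "w \<notin> set q'" "set p \<inter> set q' = {}"
        "mono_path c (\<not> a) (w # q)" "mono_path c a (p @ [w])" "w \<notin> set p" "w \<noteq> t"
      using pwq(1) snoc by (auto simp: split_path_def mono_path_Cons mono_path_append)
    have "mono_path c a (t # p @ [w])"
      using q closing snoc by (auto simp: mono_path_Cons insert_commute)
    show ?thesis
    proof (cases "c {w, t} = a")
      case True
      then have "closed_path c a (t # p @ [w])"
        using \<open>mono_path c a (t # p @ [w])\<close> by (simp add: closed_path_def)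
      then show ?thesis
        using q pwq(2) snoc by (intro exI[of _ a] exI[of _ "t # p @ [w]"] exI[of _ q']) auto
    next
      case False
      then have "closed_path c (\<not> a) (w # q)"
        using q snoc by (auto simp: closed_path_def insert_commute)
      moreover have "mono_path c a p"
        using q by (simp add: mono_path_append)
      ultimately show ?thesis
        using q pwq(2) snoc by (intro exI[of _ "\<not> a"] exI[of _ "w # q"] exI[of _ p]) auto
    qed
  qed
  have "V \<noteq> {}"
    using assms by auto
  then obtain p w q where pwq: "split_path c True False p w q" "set (p @ w # q) = V"
    using ex_split_path[of V c True False] assms(1) by auto
  have "\<exists>k D R. closed_path c k D \<and> mono_path c (\<not> k) R \<and> set D \<inter> set R = {} \<and> set D \<union> set R = V \<and> 2 \<le> length D"
  proof (cases "c {hd (p @ [w]), last (w # q)}")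
    case True
    then show ?thesis
      using half[of True p w q] pwq by auto
  next
    case False
    have "last (w # rev p) = hd (p @ [w])" "hd (rev q @ [w]) = last (w # q)"
      by (auto simp: last_rev hd_rev hd_append)
    then show ?thesis
      using half[of False "rev q" w "rev p"] split_path_rev[OF pwq(1)] pwq(2) False
      by (auto simp: insert_commute Un_commute)
  qed
  then show ?thesis
    using that by blast
qed

theorem two_cycles_cover:
  fixes c :: "'a set \<Rightarrow> bool"
  assumes "finite V"
  shows "two_cycles c V"
proof (cases "2 \<le> card V")
  case True
  show ?thesis
  proof (rule ccontr)
    assume unsolved: "\<not> two_cycles c V"
    \<comment> \<open>The maximum is taken over cycles of both colours, as \<open>maximal\<close>
      requires; it exists because lengths are at most \<open>card V\<close>.\<close>
    define good where "good n \<longleftrightarrow> (\<exists>k D R. closed_path c k D \<and> mono_path c (\<not> k) R \<and>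
      set D \<inter> set R = {} \<and> set D \<union> set R = V \<and> length D = n)" for n
    obtain n where "2 \<le> n" "good n"
      using ex_cycle_and_path[OF assms True, of c] unfolding good_def by metis
    moreover have "\<forall>m. good m \<longrightarrow> m \<le> card V"
    proof (intro allI impI)
      fix m
      assume "good m"
      then obtain D where "distinct D" "set D \<subseteq> V" "length D = m"
        unfolding good_def closed_path_def mono_path_def by blast
      then show "m \<le> card V"
        using assms by (metis card_mono distinct_card)
    qed
    ultimately obtain L where L: "good L" "\<And>m. good m \<Longrightarrow> m \<le> L" "2 \<le> L"
      using GreatestI_nat[of good n "card V"] Greatest_le_nat[of good _ "card V"] by (metis le_trans)
    then obtain k D R where D: "closed_path c k D" "mono_path c (\<not> k) R" "set D \<inter> set R = {}"
        "set D \<union> set R = V" "length D = L"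
      unfolding good_def by blast
    then obtain v where v: "int_cycle c k L v" "range v = set D"
      using closed_path_imp_int_cycle[of c k D] L(3) by auto
    interpret int_cycle c k L v
      by (rule v)
    interpret extremal c k L v R V
    proof
      show "length D' \<le> L"
        if "closed_path c k' D'" "mono_path c (\<not> k') R'" "set D' \<inter> set R' = {}" "set D' \<union> set R' = V" for k' D' R'
        using that L(2) unfolding good_def by blast
    qed (use D v unsolved in auto)
    show False
      by (rule contradiction)
  qed
next
  case False
  then have "spans_cycle c True V" "spans_cycle c False {}"
    using assms by (auto simp: spans_cycle_def)
  then show ?thesis
    unfolding two_cycles_def by (intro exI[of _ True] exI[of _ V] exI[of _ "{}"]) auto
qed

section \<open>Three colours\<close>

text \<open>The number of paths is exact and all are nonempty, since \<open>spans_cycle_join\<close>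
  alternates equally many paths from both sides.\<close>

definition path_cover :: "('a set \<Rightarrow> 'k) \<Rightarrow> 'k \<Rightarrow> 'a set \<Rightarrow> nat \<Rightarrow> bool" where
  "path_cover c a X n \<longleftrightarrow>
     (\<exists>ps. length ps = n \<and> (\<forall>s\<in>set ps. s \<noteq> [] \<and> mono_path c a s) \<and> distinct (concat ps) \<and> set (concat ps) = X)"

lemma length_le_length_concat:
  "\<forall>s\<in>set ps. s \<noteq> [] \<Longrightarrow> length ps \<le> length (concat ps)"
proof (induction ps)
  case (Cons s ps)
  then show ?case
    by (cases s) auto
qed simp

lemma path_cover_le_card: "path_cover c a X n \<Longrightarrow> n \<le> card X"
  using length_le_length_concat distinct_card by (fastforce simp: path_cover_def)

lemma path_cover_pos: "path_cover c a X n \<Longrightarrow> X \<noteq> {} \<Longrightarrow> 0 < n"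
  by (auto simp: path_cover_def)

lemma path_cover_path:
  assumes "mono_path c a xs" "xs \<noteq> []" "distinct (xs @ ys)" "set (xs @ ys) = X"
  shows "path_cover c a X (Suc (length ys))"
proof -
  have "concat (map (\<lambda>y. [y]) ys) = ys"
    by (induction ys) auto
  then show ?thesis
    using assms unfolding path_cover_def
    by (intro exI[of _ "xs # map (\<lambda>y. [y]) ys"]) (auto simp: mono_path_Cons)
qed

lemma path_cover_singletons: "finite X \<Longrightarrow> path_cover c a X (card X)"
proof -
  assume "finite X"
  then obtain xs where xs: "set xs = X" "distinct xs"
    using finite_distinct_list by blast
  have "concat (map (\<lambda>y. [y]) xs) = xs"
    by (induction xs) auto
  then show ?thesis
    using xs distinct_card[of xs] unfolding path_cover_def
    by (intro exI[of _ "map (\<lambda>y. [y]) xs"]) (auto simp: mono_path_Cons)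
qed

lemma path_cover_Suc:
  assumes "path_cover c a X n" "n < card X"
  shows "path_cover c a X (Suc n)"
proof -
  obtain ps where ps: "length ps = n" "\<forall>s\<in>set ps. s \<noteq> [] \<and> mono_path c a s" "distinct (concat ps)"
      "set (concat ps) = X"
    using assms(1) by (auto simp: path_cover_def)
  have "\<exists>s\<in>set ps. length s \<noteq> 1"
  proof (rule ccontr)
    assume "\<not> ?thesis"
    then have "length (concat ps) = length ps"
      by (induction ps) auto
    then show False
      using ps assms(2) distinct_card[of "concat ps"] by simp
  qed
  then obtain s where s: "s \<in> set ps" "length s \<noteq> 1"
    by blast
  then have "s \<noteq> []"
    using ps(2) by blast
  then obtain u t where ut: "s = u # t"
    by (cases s) auto
  then have "t \<noteq> []"
    using s(2) by auto
  obtain ps1 ps2 where "ps = ps1 @ s # ps2"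
    using s split_list by metis
  then show ?thesis
    using ps ut \<open>t \<noteq> []\<close> unfolding path_cover_def
    by (intro exI[of _ "ps1 @ [u] # t # ps2"]) (auto simp: mono_path_Cons)
qed

lemma path_cover_mono:
  assumes "path_cover c a X n" "n \<le> m" "m \<le> card X"
  shows "path_cover c a X m"
  using assms(2,3) by (induction m rule: dec_induct) (use assms(1) in \<open>auto intro: path_cover_Suc\<close>)

lemma alternate_paths:
  assumes "length ps = length qs" "ps \<noteq> []"
    and "\<forall>s\<in>set ps. s \<noteq> [] \<and> mono_path c a s" "\<forall>s\<in>set qs. s \<noteq> [] \<and> mono_path c a s"
    and "distinct (concat ps)" "distinct (concat qs)" "set (concat ps) \<inter> set (concat qs) = {}"
    and "\<And>u w. u \<in> set (concat ps) \<Longrightarrow> w \<in> set (concat qs) \<Longrightarrow> c {u, w} = a"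
  shows "\<exists>zs. zs \<noteq> [] \<and> mono_path c a zs \<and> set zs = set (concat ps) \<union> set (concat qs) \<and>
           hd zs \<in> set (concat ps) \<and> last zs \<in> set (concat qs)"
  using assms
proof (induction ps qs rule: list_induct2)
  case (Cons s ps t qs)
  have st: "s \<noteq> []" "t \<noteq> []" "mono_path c a s" "mono_path c a t"
    using Cons.prems by auto
  then have in_st: "hd s \<in> set s" "last s \<in> set s" "hd t \<in> set t" "last t \<in> set t"
    by auto
  have "c {last s, hd t} = a"
    using Cons.prems(7) in_st by auto
  then have path: "mono_path c a (s @ t)"
    using st Cons.prems(6) by (auto simp: mono_path_append)
  show ?case
  proof (cases "ps = []")
    case True
    then show ?thesis
      using path st in_st Cons.hyps by (intro exI[of _ "s @ t"]) auto
  next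
    case False
    then obtain zs where zs: "zs \<noteq> []" "mono_path c a zs" "set zs = set (concat ps) \<union> set (concat qs)"
      "hd zs \<in> set (concat ps)" "last zs \<in> set (concat qs)"
      using Cons.IH Cons.prems by (auto simp: Int_Un_distrib Int_Un_distrib2)
    have "c {last t, hd zs} = a"
      using Cons.prems(7)[of "hd zs" "last t"] in_st zs by (auto simp: insert_commute)
    moreover have "set (s @ t) \<inter> set zs = {}"
      using Cons.prems zs(3) by auto
    ultimately have "mono_path c a ((s @ t) @ zs)"
      using path zs st unfolding mono_path_append[of _ _ "s @ t"] by auto
    then show ?thesis
      using zs st in_st by (intro exI[of _ "(s @ t) @ zs"]) auto
  qed
qed simp

text \<open>The paths of \<open>X\<close> and \<open>Y\<close> are visited alternately; every
  passage, including the closing one, is an edge between \<open>X\<close> and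
  \<open>Y\<close>.\<close>

lemma spans_cycle_join:
  assumes "path_cover c a X n" "path_cover c a Y n" "X \<inter> Y = {}" "\<And>u w. u \<in> X \<Longrightarrow> w \<in> Y \<Longrightarrow> c {u, w} = a"
  shows "spans_cycle c a (X \<union> Y)"
proof (cases "n = 0")
  case True
  then have "X \<union> Y = {}"
    using path_cover_pos[OF assms(1)] path_cover_pos[OF assms(2)] by auto
  then show ?thesis
    by simp
next
  case False
  obtain ps where ps: "length ps = n" "\<forall>s\<in>set ps. s \<noteq> [] \<and> mono_path c a s" "distinct (concat ps)"
      "set (concat ps) = X"
    using assms(1) by (auto simp: path_cover_def)
  obtain qs where qs: "length qs = n" "\<forall>s\<in>set qs. s \<noteq> [] \<and> mono_path c a s" "distinct (concat qs)"
      "set (concat qs) = Y"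
    using assms(2) by (auto simp: path_cover_def)
  have "length ps = length qs" "ps \<noteq> []"
    using ps(1) qs(1) False by auto
  from alternate_paths[OF this ps(2) qs(2) ps(3) qs(3), unfolded ps(4) qs(4), OF assms(3,4)]
  obtain zs where "zs \<noteq> []" "mono_path c a zs" "set zs = X \<union> Y" "hd zs \<in> X" "last zs \<in> Y"
    by blast
  then show ?thesis
    using assms(4)[of "hd zs" "last zs"] spans_cycleI[of c a zs] by (simp add: closed_path_def insert_commute)
qed

definition partitioned :: "('a set \<Rightarrow> nat) \<Rightarrow> 'a set \<Rightarrow> bool" where
  "partitioned c V \<longleftrightarrow>
     (\<exists>S T a b. a \<noteq> b \<and> S \<inter> T = {} \<and> S \<union> T = V \<and> spans_cycle c a S \<and> spans_cycle c b T)"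

section \<open>Covering one palette class by paths of either colour\<close>

lemma path_covers_or_cycle_aux:
  assumes "split_path c a b p w q" "set (p @ w # q) = X" "c {hd (p @ [w]), last (w # q)} = a"
  shows "(\<exists>i j. path_cover c a X i \<and> path_cover c b X j \<and> i + j \<le> card X) \<or> spans_cycle c a X \<and> path_cover c a X 1"
proof (cases q rule: rev_cases)
  case Nil
  then have "closed_path c a (p @ [w])"
    using assms by (auto simp: split_path_def closed_path_def insert_commute)
  moreover have "path_cover c a X 1"
    using path_cover_path[of c a "p @ [w]" "[]" X] assms Nil
    by (auto simp: split_path_def mono_path_def)
  ultimately show ?thesis
    using assms(2) Nil by (auto intro: spans_cycleI)
next
  case (snoc q' t)
  have q: "t \<notin> set (p @ [w])" "t \<notin> set q'" "w \<notin> set q'" "set p \<inter> set q' = {}" "distinct q'" "distinct p"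
      "mono_path c b (w # q)" "mono_path c a (p @ [w])" "w \<notin> set p" "w \<noteq> t"
    using assms(1) snoc by (auto simp: split_path_def mono_path_def)
  have "mono_path c a (t # p @ [w])"
    using q assms(3) snoc by (auto simp: mono_path_Cons insert_commute)
  \<comment> \<open>In each colour one long path is completed by singletons; the closing edge brings
    \<open>t\<close> into the \<open>a\<close>-path, which lowers the total number of paths to
    \<open>card X\<close>.\<close>
  then have 1: "path_cover c a X (Suc (length q'))"
    using q assms(2) snoc by (intro path_cover_path[of c a "t # p @ [w]" q']) auto
  have 2: "path_cover c b X (Suc (length p))"
    using q assms(2) snoc by (intro path_cover_path[of c b "w # q" p]) auto
  have "card X = length (p @ w # q' @ [t])"
    using q assms(2) snoc distinct_card[of "p @ w # q' @ [t]"] by auto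
  then have "Suc (length q') + Suc (length p) \<le> card X"
    by simp
  then show ?thesis
    using 1 2 by blast
qed

lemma path_covers_or_cycle:
  assumes "finite X" "X \<noteq> {}" "\<And>u w. u \<in> X \<Longrightarrow> w \<in> X \<Longrightarrow> u \<noteq> w \<Longrightarrow> c {u, w} \<in> {a, b}"
  shows "(\<exists>i j. path_cover c a X i \<and> path_cover c b X j \<and> i + j \<le> card X) \<or>
     spans_cycle c a X \<and> path_cover c a X 1 \<or> spans_cycle c b X \<and> path_cover c b X 1"
proof -
  obtain p w q where pwq: "split_path c a b p w q" "set (p @ w # q) = X"
    using ex_split_path[of X c a b] assms by auto
  define s t where "s = hd (p @ [w])" and "t = last (w # q)"
  have st: "s \<in> X" "t \<in> X"
    using pwq(2) hd_in_set[of "p @ [w]"] last_in_set[of "w # q"] by (auto simp: s_def t_def)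
  consider "s = t" | "c {s, t} = a" | "c {t, s} = b"
    using assms(3) st by (force simp: insert_commute)
  then show ?thesis
  proof cases
    case 1
    have "s \<in> set (p @ [w])" "t \<in> set (w # q)"
      unfolding s_def t_def by (rule hd_in_set last_in_set; simp)+
    then have "s = w" "t = w"
      using 1 pwq(1) by (auto simp: split_path_def mono_path_def)
    have "p = []"
      using \<open>s = w\<close> pwq(1) by (cases p) (auto simp: s_def split_path_def mono_path_def)
    moreover have "q = []"
      using \<open>t = w\<close> pwq(1) by (cases q rule: rev_cases) (auto simp: t_def split_path_def mono_path_def)
    ultimately have "X = {w}"
      using pwq(2) by simp
    then have "spans_cycle c a X" "path_cover c a X 1"
      using path_cover_singletons[of X c a] by (auto simp: spans_cycle_def)
    then show ?thesis
      by blast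
  next
    case 2
    then show ?thesis
      using path_covers_or_cycle_aux[OF pwq] by (auto simp: s_def t_def)
  next
    case 3
    have "hd (rev q @ [w]) = t" "last (w # rev p) = s"
      by (auto simp: s_def t_def last_rev hd_rev hd_append)
    then have "c {hd (rev q @ [w]), last (w # rev p)} = b"
      using 3 by simp
    moreover have "set (rev q @ w # rev p) = X"
      using pwq(2) by auto
    ultimately show ?thesis
      using path_covers_or_cycle_aux[OF split_path_rev[OF pwq(1)]] by (metis add.commute)
  qed
qed

lemma path_covers_weak:
  assumes "finite X" "X \<noteq> {}" "\<And>u w. u \<in> X \<Longrightarrow> w \<in> X \<Longrightarrow> u \<noteq> w \<Longrightarrow> c {u, w} \<in> {a, b}"
  obtains i j where "path_cover c a X i" "path_cover c b X j" "i + j \<le> card X + 1"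
proof -
  have 1: "path_cover c a X (card X)" "path_cover c b X (card X)"
    using assms(1) by (auto intro: path_cover_singletons)
  consider i j where "path_cover c a X i" "path_cover c b X j" "i + j \<le> card X"
    | "path_cover c a X 1" | "path_cover c b X 1"
    using path_covers_or_cycle[of X c a b] assms by blast
  then show ?thesis
    using that[of 1 "card X"] that[of "card X" 1] 1 by cases (auto intro: that)
qed

text \<open>The palette of the vertices in \<^term>\<open>A\<close>, \<^term>\<open>B\<close>, \<^term>\<open>D\<close> is
  \<^term>\<open>{p, q}\<close>, \<^term>\<open>{p, r}\<close>, \<^term>\<open>{q, r}\<close>, respectively.\<close>

definition triangle :: "('a set \<Rightarrow> nat) \<Rightarrow> 'a set \<Rightarrow> 'a set \<Rightarrow> 'a set \<Rightarrow> nat \<Rightarrow> nat \<Rightarrow> nat \<Rightarrow> bool" where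
  "triangle c A B D p q r \<longleftrightarrow> finite A \<and> finite B \<and> finite D \<and> A \<noteq> {} \<and> B \<noteq> {} \<and> D \<noteq> {} \<and>
     A \<inter> B = {} \<and> A \<inter> D = {} \<and> B \<inter> D = {} \<and> p \<noteq> q \<and> p \<noteq> r \<and> q \<noteq> r \<and>
     (\<forall>u\<in>A. \<forall>w\<in>B. c {u, w} = p) \<and> (\<forall>u\<in>A. \<forall>w\<in>D. c {u, w} = q) \<and> (\<forall>u\<in>B. \<forall>w\<in>D. c {u, w} = r) \<and>
     (\<forall>u\<in>A. \<forall>w\<in>A. u \<noteq> w \<longrightarrow> c {u, w} \<in> {p, q}) \<and> (\<forall>u\<in>B. \<forall>w\<in>B. u \<noteq> w \<longrightarrow> c {u, w} \<in> {p, r}) \<and>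
     (\<forall>u\<in>D. \<forall>w\<in>D. u \<noteq> w \<longrightarrow> c {u, w} \<in> {q, r})"

section \<open>Three palette classes\<close>

lemma triangle_swap1:
  assumes t: "triangle c A B D p q r"
  shows "triangle c A D B q p r"
proof -
  have "c {u, w} = r" if "u \<in> D" "w \<in> B" for u w
    by (subst insert_commute) (use t that in \<open>simp add: triangle_def\<close>)
  then show ?thesis
    using t unfolding triangle_def by auto
qed

text \<open>The two swaps generate all relabellings of the classes, so \<open>A\<close> can always
  be the class that is divided.\<close>

lemma triangle_swap2:
  assumes t: "triangle c A B D p q r"
  shows "triangle c B A D p r q"
proof -
  have "c {u, w} = p" if "u \<in> B" "w \<in> A" for u w
    by (subst insert_commute) (use t that in \<open>simp add: triangle_def\<close>)
  then show ?thesis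
    using t unfolding triangle_def by auto
qed

lemma triangleD:
  assumes "triangle c A B D p q r"
  shows "finite A" "finite B" "finite D" "A \<noteq> {}" "B \<noteq> {}" "D \<noteq> {}"
    and "A \<inter> B = {}" "A \<inter> D = {}" "B \<inter> D = {}" "p \<noteq> q" "p \<noteq> r" "q \<noteq> r"
    and "u \<in> A \<Longrightarrow> w \<in> B \<Longrightarrow> c {u, w} = p" "u \<in> A \<Longrightarrow> w \<in> D \<Longrightarrow> c {u, w} = q"
  using assms by (simp_all add: triangle_def)

text \<open>One part of \<open>A\<close> is joined with \<open>B\<close> in colour \<open>p\<close>
  and the other with \<open>D\<close> in colour \<open>q\<close>, each by
  \<open>spans_cycle_join\<close>.\<close>

lemma triangle_split:
  assumes t: "triangle c A B D p q r"
    and "A1 \<union> A2 = A" "A1 \<inter> A2 = {}"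
    and "path_cover c p A1 m" "path_cover c p B m" "path_cover c q A2 n" "path_cover c q D n"
  shows "partitioned c (A \<union> B \<union> D)"
proof -
  have "spans_cycle c p (A1 \<union> B)"
    by (rule spans_cycle_join[OF assms(4,5)]) (use triangleD[OF t] assms(2) in blast)+
  moreover have "spans_cycle c q (A2 \<union> D)"
    by (rule spans_cycle_join[OF assms(6,7)]) (use triangleD[OF t] assms(2) in blast)+
  moreover have "(A1 \<union> B) \<inter> (A2 \<union> D) = {}" "(A1 \<union> B) \<union> (A2 \<union> D) = A \<union> B \<union> D"
    using triangleD(7-9)[OF t] assms(2,3) by blast+
  ultimately show ?thesis
    unfolding partitioned_def using triangleD(10)[OF t] by blast
qed

text \<open>\<open>A\<close> is used as singletons, so its two parts may have any sizes to which the
  covers of \<open>B\<close> and \<open>D\<close> can be refined.\<close>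

lemma triangle_middle:
  assumes t: "triangle c A B D p q r"
    and i: "path_cover c p B i" and j: "path_cover c q D j" and "i + j \<le> card A" "card A \<le> card B + card D"
  shows "partitioned c (A \<union> B \<union> D)"
proof -
  have fin: "finite A" "finite B" "finite D"
    using t by (auto simp: triangle_def)
  \<comment> \<open>This is the least size of \<open>A1\<close> that reaches \<open>i\<close> and
    leaves at most \<open>card D\<close> vertices for the other part.\<close>
  define n where "n = max i (card A - card D)"
  have n: "i \<le> n" "n \<le> card B" "j \<le> card A - n" "card A - n \<le> card D" "n \<le> card A"
    using path_cover_le_card[OF i] path_cover_le_card[OF j] assms(4,5) by (auto simp: n_def)
  obtain A1 where A1: "A1 \<subseteq> A" "card A1 = n"
    using n(5) by (meson obtain_subset_with_card_n)
  then have "card (A - A1) = card A - n"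
    using fin by (simp add: card_Diff_subset finite_subset)
  then have "path_cover c q (A - A1) (card A - n)" "path_cover c p A1 n"
    using path_cover_singletons fin A1 by (metis finite_Diff, metis finite_subset)
  then show ?thesis
    using triangle_split[OF t, of A1 "A - A1" n "card A - n"] A1 n path_cover_mono[OF i, of n]
      path_cover_mono[OF j, of "card A - n"] by auto
qed

text \<open>The first \<open>card B\<close> vertices of the path are matched as singletons with
  those of \<open>B\<close>. They include the pivot, so the rest is a path of colour
  \<open>q\<close>, which can be cut into \<open>card D\<close> pieces.\<close>

lemma triangle_large_aux:
  assumes t: "triangle c A B D p q r"
    and s: "split_path c p q xs w ys" "set (xs @ w # ys) = A"
    and "length xs + 1 \<le> card B" "card B + card D \<le> card A"
  shows "partitioned c (A \<union> B \<union> D)"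
proof -
  have fin: "finite A" "finite B" "finite D" "0 < card D"
    using t by (auto simp: triangle_def card_gt_0_iff)
  define m where "m = card B - (length xs + 1)"
  have d: "distinct (xs @ w # ys)"
    using s by (auto simp: split_path_def mono_path_def)
  have cA: "card A = length xs + 1 + length ys"
    using distinct_card[OF d] s(2) by simp
  obtain y1 y2 where y: "ys = y1 @ y2" "length y1 = m"
    using that[of "take m ys" "drop m ys"] assms(4,5) cA by (auto simp: m_def)
  let ?zs = "xs @ w # y1"
  have dz: "distinct ?zs" "distinct y2" "set ?zs \<inter> set y2 = {}" "set ?zs \<union> set y2 = A"
    using d s(2) y(1) by auto
  have len: "length ?zs = card B" "card D \<le> length y2"
    using assms(4,5) cA y by (auto simp: m_def)
  have "path_cover c p (set ?zs) (card B)"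
    using path_cover_singletons[of "set ?zs" c p] distinct_card[OF dz(1)] len(1) by simp
  moreover have "path_cover c p B (card B)" "path_cover c q D (card D)"
    using fin by (auto intro: path_cover_singletons)
  moreover have "path_cover c q (set y2) (card D)"
  proof -
    have "mono_path c q ((w # y1) @ y2)"
      using s y by (simp add: split_path_def)
    then have "mono_path c q y2"
      unfolding mono_path_append by blast
    moreover have "y2 \<noteq> []"
      using fin len(2) by auto
    ultimately have "path_cover c q (set y2) 1"
      using path_cover_path[of c q y2 "[]" "set y2"] dz(2) by simp
    then show ?thesis
      by (rule path_cover_mono) (use len(2) fin distinct_card[OF dz(2)] in auto)
  qed
  ultimately show ?thesis
    using triangle_split[OF t dz(4,3)] by blast
qed

text \<open>If neither side of the path is short, it is cut after the pivot, and both sides are long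
  enough to be cut into \<open>card B\<close> and \<open>card D\<close> pieces.\<close>

lemma triangle_large:
  assumes t: "triangle c A B D p q r" and "card B + card D \<le> card A"
  shows "partitioned c (A \<union> B \<union> D)"
proof -
  have fin: "finite A" "finite B" "finite D" "0 < card D" "0 < card B" "A \<noteq> {}"
    using t by (auto simp: triangle_def card_gt_0_iff)
  obtain xs w ys where s: "split_path c p q xs w ys" "set (xs @ w # ys) = A"
    using ex_split_path[of A c p q] t by (auto simp: triangle_def)
  consider "length xs + 1 \<le> card B" | "length (rev ys) + 1 \<le> card D" | "card B \<le> length xs + 1" "card D \<le> length ys"
    by fastforce
  then show ?thesis
  proof cases
    case 1
    then show ?thesis
      using triangle_large_aux[OF t s] assms(2) by simp
  next
    case 2
    have "set (rev ys @ w # rev xs) = A"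
      using s(2) by auto
    then show ?thesis
      using triangle_large_aux[OF triangle_swap1[OF t] split_path_rev[OF s(1)]] 2 assms(2)
      by (simp add: ac_simps)
  next
    case 3
    have d: "distinct (xs @ [w])" "distinct ys" "set (xs @ [w]) \<inter> set ys = {}" "mono_path c p (xs @ [w])"
      "mono_path c q ys"
      using s by (auto simp: split_path_def mono_path_def mono_path_Cons successively_Cons)
    have 1: "path_cover c p (set (xs @ [w])) (card B)"
      using path_cover_mono[OF path_cover_path[of c p "xs @ [w]" "[]"]] d distinct_card[OF d(1)] 3 fin by auto
    have 2: "path_cover c q (set ys) (card D)"
      using path_cover_mono[OF path_cover_path[of c q ys "[]"]] d distinct_card[OF d(2)] 3 fin
      by (cases "ys = []") auto
    have "set (xs @ [w]) \<union> set ys = A"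
      using s(2) by auto
    then show ?thesis
      by (rule triangle_split[OF t _ d(3) 1 _ 2]) (use fin in \<open>auto intro: path_cover_singletons\<close>)
  qed
qed

text \<open>A \<open>p\<close>-cover of \<open>B\<close> by at most \<open>card A\<close> paths
  could be matched by cutting the \<open>p\<close>-path of \<open>A\<close>, so
  \<open>A \<union> B\<close> would be a \<open>p\<close>-cycle beside the cycle on
  \<open>D\<close>. Both claims follow, since \<open>card B\<close> singletons cover
  \<open>B\<close>.\<close>

lemma triangle_pair:
  assumes t: "triangle c A B D p q r" and "\<not> partitioned c (A \<union> B \<union> D)"
    and "path_cover c p A 1" "spans_cycle c q D \<or> spans_cycle c r D"
  shows "card A < card B \<and> \<not> path_cover c p B 1"
proof -
  have fin: "finite A" "finite B" "A \<noteq> {}" "B \<noteq> {}"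
    using triangleD[OF t] by auto
  have "card A < n" if n: "path_cover c p B n" for n
  proof (rule ccontr)
    assume "\<not> card A < n"
    then have "path_cover c p A n"
      using path_cover_mono[OF assms(3)] path_cover_pos[OF n] fin by simp
    then have "spans_cycle c p (A \<union> B)"
      by (rule spans_cycle_join[OF _ n]) (use triangleD[OF t] in blast)+
    moreover obtain a where "p \<noteq> a" "spans_cycle c a D"
      using assms(4) triangleD(10,11)[OF t] by blast
    moreover have "(A \<union> B) \<inter> D = {}"
      using triangleD(8,9)[OF t] by blast
    ultimately have "partitioned c (A \<union> B \<union> D)"
      unfolding partitioned_def by blast
    then show False
      using assms(2) by simp
  qed
  moreover have "card A \<noteq> 0"
    using fin by simp
  ultimately show ?thesis
    using path_cover_singletons[OF fin(2)] by (metis less_one)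
qed

lemma triangle_partitioned:
  assumes t: "triangle c A B D p q r"
  shows "partitioned c (A \<union> B \<union> D)"
proof (rule ccontr)
  assume no: "\<not> partitioned c (A \<union> B \<union> D)"
  note tB = triangle_swap2[OF t]
  note tD = triangle_swap2[OF triangle_swap1[OF t]]
  have V: "B \<union> A \<union> D = A \<union> B \<union> D" "D \<union> A \<union> B = A \<union> B \<union> D" "A \<union> D \<union> B = A \<union> B \<union> D"
    "B \<union> D \<union> A = A \<union> B \<union> D" "D \<union> B \<union> A = A \<union> B \<union> D"
    by auto
  have fin: "finite A" "finite B" "finite D" "A \<noteq> {}" "B \<noteq> {}" "D \<noteq> {}"
    using t by (auto simp: triangle_def)
  have size: "card A < card B + card D" "card B < card A + card D" "card D < card A + card B"
    using triangle_large[OF t] triangle_large[OF tB] triangle_large[OF tD] no V by (auto simp: not_le[symmetric])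
  \<comment> \<open>The size condition of \<open>triangle_middle\<close> holds for each class in
    turn, so the condition on the covers must fail.\<close>
  have mid: "path_cover c p B i \<Longrightarrow> path_cover c q D j \<Longrightarrow> card A < i + j"
    "path_cover c p A i \<Longrightarrow> path_cover c r D j \<Longrightarrow> card B < i + j"
    "path_cover c q A i \<Longrightarrow> path_cover c r B j \<Longrightarrow> card D < i + j" for i j
    using triangle_middle[OF t, of i j] triangle_middle[OF tB, of i j] triangle_middle[OF tD, of i j] no V size
    by (auto simp: not_le[symmetric])
  have alt: "(\<exists>i j. path_cover c p A i \<and> path_cover c q A j \<and> i + j \<le> card A) \<or>
      spans_cycle c p A \<and> path_cover c p A 1 \<or> spans_cycle c q A \<and> path_cover c q A 1"
    "(\<exists>i j. path_cover c p B i \<and> path_cover c r B j \<and> i + j \<le> card B) \<or>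
      spans_cycle c p B \<and> path_cover c p B 1 \<or> spans_cycle c r B \<and> path_cover c r B 1"
    "(\<exists>i j. path_cover c q D i \<and> path_cover c r D j \<and> i + j \<le> card D) \<or>
      spans_cycle c q D \<and> path_cover c q D 1 \<or> spans_cycle c r D \<and> path_cover c r D 1"
    by (rule path_covers_or_cycle; use t in \<open>auto simp: triangle_def\<close>)+
  obtain i1 j1 where A: "path_cover c p A i1" "path_cover c q A j1" "i1 + j1 \<le> card A + 1"
    by (rule path_covers_weak[of A c p q]) (use t in \<open>auto simp: triangle_def\<close>)
  obtain i2 j2 where B: "path_cover c p B i2" "path_cover c r B j2" "i2 + j2 \<le> card B + 1"
    by (rule path_covers_weak[of B c p r]) (use t in \<open>auto simp: triangle_def\<close>)
  obtain i3 j3 where D: "path_cover c q D i3" "path_cover c r D j3" "i3 + j3 \<le> card D + 1"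
    by (rule path_covers_weak[of D c q r]) (use t in \<open>auto simp: triangle_def\<close>)
  \<comment> \<open>By the three bounds of \<open>mid\<close> the six covers have at least 3 paths
    more than there are vertices; with \<open>i + j \<le> card A\<close> and the weak covers of
    \<open>B\<close> and \<open>D\<close> the excess is at most 2.\<close>
  have "\<not> i + j \<le> card A" if "path_cover c p A i" "path_cover c q A j" for i j
    using mid(1)[OF B(1) D(1)] mid(2)[OF that(1) D(2)] mid(3)[OF that(2) B(2)] B(3) D(3) by linarith
  then have A': "spans_cycle c p A \<and> path_cover c p A 1 \<or> spans_cycle c q A \<and> path_cover c q A 1"
    using alt(1) by blast
  have "\<not> i + j \<le> card B" if "path_cover c p B i" "path_cover c r B j" for i j
    using mid(1)[OF that(1) D(1)] mid(2)[OF A(1) D(2)] mid(3)[OF A(2) that(2)] A(3) D(3) by linarith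
  then have B': "spans_cycle c p B \<and> path_cover c p B 1 \<or> spans_cycle c r B \<and> path_cover c r B 1"
    using alt(2) by blast
  have "\<not> i + j \<le> card D" if "path_cover c q D i" "path_cover c r D j" for i j
    using mid(1)[OF B(1) that(1)] mid(2)[OF A(1) that(2)] mid(3)[OF A(2) B(2)] A(3) B(3) by linarith
  then have D': "spans_cycle c q D \<and> path_cover c q D 1 \<or> spans_cycle c r D \<and> path_cover c r D 1"
    using alt(3) by blast
  have AB: "path_cover c p A 1 \<Longrightarrow> card A < card B \<and> \<not> path_cover c p B 1"
    using triangle_pair[OF t no] D' by blast
  have BA: "path_cover c p B 1 \<Longrightarrow> card B < card A \<and> \<not> path_cover c p A 1"
    using triangle_pair[OF tB] no D' V by auto
  have AD: "path_cover c q A 1 \<Longrightarrow> card A < card D \<and> \<not> path_cover c q D 1"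
    using triangle_pair[OF triangle_swap1[OF t]] no B' V by auto
  have DA: "path_cover c q D 1 \<Longrightarrow> card D < card A \<and> \<not> path_cover c q A 1"
    using triangle_pair[OF tD] no B' V by auto
  have BD: "path_cover c r B 1 \<Longrightarrow> card B < card D \<and> \<not> path_cover c r D 1"
    using triangle_pair[OF triangle_swap1[OF tB]] no A' V by auto
  have DB: "path_cover c r D 1 \<Longrightarrow> card D < card B \<and> \<not> path_cover c r B 1"
    using triangle_pair[OF triangle_swap1[OF tD]] no A' V by auto
  \<comment> \<open>Each class is a single path in one of its colours. By the six facts above this
    moves the colour choice around the triangle in one direction with strictly growing sizes, absurd
    after three steps.\<close>
  show False
    using A' B' D' AB BA AD DA BD DB by linarith
qed

section \<open>A colour common to the palettes\<close>

lemma star_propagate: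
  assumes "\<And>u v w. u \<in> V \<Longrightarrow> v \<in> V \<Longrightarrow> w \<in> V \<Longrightarrow> u \<noteq> v \<Longrightarrow> w \<noteq> v \<Longrightarrow> c {v, u} \<noteq> g \<Longrightarrow> c {v, w} \<noteq> g \<Longrightarrow>
      c {v, u} = c {v, w}"
    and "set (u # v # xs) \<subseteq> V" "distinct (u # v # xs)" "successively (\<lambda>u w. c {u, w} \<noteq> g) (u # v # xs)"
  shows "successively (\<lambda>s t. c {s, t} = c {u, v}) (u # v # xs)"
  using assms(2-)
proof (induction xs arbitrary: u v)
  case (Cons w xs)
  have "successively (\<lambda>s t. c {s, t} = c {v, w}) (v # w # xs)"
    using Cons by simp
  \<comment> \<open>At \<open>v\<close> all edges avoiding \<open>g\<close> have one colour, so the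
    path cannot change colour there.\<close>
  moreover have "c {v, u} = c {v, w}"
    by (rule assms(1)) (use Cons.prems in \<open>auto simp: insert_commute\<close>)
  ultimately show ?case
    by (auto simp: insert_commute)
qed simp

text \<open>The two-colour theorem is applied after merging all colours other than \<open>g\<close>;
  the cycle avoiding \<open>g\<close> keeps one original colour, because no vertex sees two of the
  merged colours.\<close>

lemma star_partitioned:
  assumes "finite V"
    and star: "\<And>u v w. u \<in> V \<Longrightarrow> v \<in> V \<Longrightarrow> w \<in> V \<Longrightarrow> u \<noteq> v \<Longrightarrow> w \<noteq> v \<Longrightarrow> c {v, u} \<noteq> g \<Longrightarrow> c {v, w} \<noteq> g \<Longrightarrow>
      c {v, u} = c {v, w}"
  shows "partitioned c V"
proof -
  have "two_cycles (\<lambda>e. c e = g) V"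
    by (rule two_cycles_cover[OF assms(1)])
  then obtain k S' T' where "spans_cycle (\<lambda>e. c e = g) k S'" "spans_cycle (\<lambda>e. c e = g) (\<not> k) T'"
      "S' \<inter> T' = {}" "S' \<union> T' = V"
    by (auto simp: two_cycles_def)
  then obtain S T where ST: "spans_cycle (\<lambda>e. c e = g) True S" "spans_cycle (\<lambda>e. c e = g) False T"
      "S \<inter> T = {}" "S \<union> T = V"
    by (cases k) (auto simp: Int_commute Un_commute)
  have S: "spans_cycle c g S"
    using ST(1) by (simp add: spans_cycle_def closed_path_def mono_path_def)
  have "\<exists>b. b \<noteq> g \<and> spans_cycle c b T"
  proof (cases "finite T \<and> card T \<le> 2")
    case True
    \<comment> \<open>At most two vertices form a cycle of any colour; \<open>Suc g\<close> is
      merely a colour other than \<open>g\<close>.\<close>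
    then show ?thesis
      by (intro exI[of _ "Suc g"]) (simp add: spans_cycle_def)
  next
    case False
    then obtain xs where xs: "distinct xs" "successively (\<lambda>u w. c {u, w} \<noteq> g) xs" "c {last xs, hd xs} \<noteq> g"
        "set xs = T"
      using ST(2) by (auto simp: spans_cycle_def closed_path_def mono_path_def)
    have "3 \<le> length xs"
      using False xs distinct_card[of xs] by auto
    then obtain u v w ys where ys: "xs = u # v # w # ys"
      by (metis One_nat_def Suc_1 Suc_le_length_iff numeral_3_eq_3)
    have "set xs \<subseteq> V"
      using xs(4) ST(4) by auto
    then have "successively (\<lambda>s t. c {s, t} = c {u, v}) xs"
      using star_propagate[of V c g u v "w # ys", OF star] xs ys by auto
    moreover have "c {last xs, hd xs} = c {u, v}"
    proof -
      have "last (w # ys) \<in> set (w # ys)"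
        by (rule last_in_set) simp
      then have "last xs \<in> V" "last xs \<noteq> u"
        using ys \<open>set xs \<subseteq> V\<close> xs(1) by auto
      then have "c {u, last xs} = c {u, v}"
        using star[of "last xs" u v] xs ys \<open>set xs \<subseteq> V\<close> by (auto simp: insert_commute)
      then show ?thesis
        using ys by (simp add: insert_commute)
    qed
    ultimately have "closed_path c (c {u, v}) xs"
      using xs(1) ys by (simp add: closed_path_def mono_path_def)
    moreover have "c {u, v} \<noteq> g"
      using xs(2) ys by simp
    ultimately show ?thesis
      using xs(4) by (blast intro: spans_cycleI)
  qed
  then show ?thesis
    using S ST(3,4) unfolding partitioned_def by metis
qed

text \<open>Two palettes share the colour of the edge between their vertices, and pairwise
  intersecting two-element sets either have a common element or are the three pairs of a
  three-element set.\<close>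

lemma palette_cases:
  assumes "finite V" "V \<noteq> {}" "two_local V c"
  defines "pal \<equiv> \<lambda>v. (\<lambda>w. c {v, w}) ` (V - {v})"
  obtains (star) g where "\<And>v. v \<in> V \<Longrightarrow> g \<in> pal v \<or> card (pal v) \<le> 1"
    | (triangle) p q r where "p \<noteq> q" "p \<noteq> r" "q \<noteq> r" "\<And>v. v \<in> V \<Longrightarrow> pal v \<in> {{p, q}, {p, r}, {q, r}}"
      "\<And>P. P \<in> {{p, q}, {p, r}, {q, r}} \<Longrightarrow> \<exists>v\<in>V. pal v = P"
proof -
  have fin: "finite (pal v)" for v
    using assms(1) by (simp add: pal_def)
  have le2: "card (pal v) \<le> 2" if "v \<in> V" for v
    using assms(3) that by (simp add: two_local_def pal_def)
  have common: "c {u, v} \<in> pal u \<inter> pal v" if "u \<in> V" "v \<in> V" "u \<noteq> v" for u v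
    using that by (auto simp: pal_def insert_commute)
  show ?thesis
  proof (cases "\<exists>g. \<forall>v\<in>V. g \<in> pal v \<or> card (pal v) \<le> 1")
    case True
    then show ?thesis
      using star by blast
  next
    case False
    \<comment> \<open>A palette inside \<open>{g}\<close> forces \<open>g\<close> into the palette
      of every other vertex, which is the first case.\<close>
    have two: "card (pal v) = 2" if v: "v \<in> V" for v
    proof (rule ccontr)
      assume "card (pal v) \<noteq> 2"
      then have "card (pal v) \<le> 1"
        using le2[OF v] by simp
      then obtain g where g: "pal v \<subseteq> {g}"
        using fin by (metis card_le_Suc0_iff_eq One_nat_def empty_subsetI ex_in_conv insertCI subsetI)
      then have "g \<in> pal u \<or> card (pal u) \<le> 1" if "u \<in> V" for u
        using common[OF that v] \<open>card (pal v) \<le> 1\<close> by blast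
      then show False
        using False by blast
    qed
    then have avoid: "\<exists>v\<in>V. g \<notin> pal v" for g
      using False by blast
    have meet: "pal u \<inter> pal v \<noteq> {}" if "u \<in> V" "v \<in> V" for u v
      using common[OF that] two[OF that(1)] by (cases "u = v") auto
    have pair: "pal v = {a, b}" if "v \<in> V" "a \<in> pal v" "b \<in> pal v" "a \<noteq> b" for v a b
      using card_subset_eq[of "pal v" "{a, b}"] two fin that by auto
    obtain u where u: "u \<in> V"
      using assms(2) by blast
    obtain p q where pq: "pal u = {p, q}" "p \<noteq> q"
      using two[OF u] by (auto simp: card_2_iff)
    obtain v where v: "v \<in> V" "p \<notin> pal v"
      using avoid by blast
    have "q \<in> pal v"
      using meet[OF u v(1)] pq v(2) by auto
    then obtain r where r: "r \<in> pal v" "q \<noteq> r"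
      using two[OF v(1)] by (auto simp: card_2_iff)
    then have "pal v = {q, r}"
      using pair[OF v(1) \<open>q \<in> pal v\<close>] by blast
    note r = this r(2)
    obtain w where w: "w \<in> V" "q \<notin> pal w"
      using avoid by blast
    have "p \<in> pal w" "r \<in> pal w"
      using meet[OF u w(1)] meet[OF v(1) w(1)] pq r w(2) by auto
    have "p \<noteq> r"
      using r v by auto
    have "pal w = {p, r}"
      by (rule pair) fact+
    have "pal z \<in> {{p, q}, {p, r}, {q, r}}" if z: "z \<in> V" for z
    proof -
      have "pal z \<inter> {p, q} \<noteq> {}" "pal z \<inter> {p, r} \<noteq> {}" "pal z \<inter> {q, r} \<noteq> {}"
        using meet[OF z] u v(1) w(1) pq(1) r(1) \<open>pal w = {p, r}\<close> by metis+
      then consider "p \<in> pal z" "q \<in> pal z" | "p \<in> pal z" "r \<in> pal z" | "q \<in> pal z" "r \<in> pal z"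
        by blast
      then show ?thesis
        using pair[OF z] pq(2) r(2) \<open>p \<noteq> r\<close> by cases blast+
    qed
    moreover have "\<exists>v\<in>V. pal v = P" if "P \<in> {{p, q}, {p, r}, {q, r}}" for P
      using that u v(1) w(1) pq(1) r(1) \<open>pal w = {p, r}\<close> by blast
    ultimately show ?thesis
      using triangle[of p q r] pq(2) r(2) \<open>p \<noteq> r\<close> by blast
  qed
qed

theorem theorem1p2:
  fixes V :: "'a set" and c :: "'a set \<Rightarrow> nat" and n :: nat
  assumes "finite V" and "card V = n" and "1 \<le> n"
    and "two_local V c"
  shows "\<exists>S1 S2 a b. a \<noteq> b \<and> S1 \<inter> S2 = {} \<and> S1 \<union> S2 = V \<and>
           mono_cycle c a S1 \<and> mono_cycle c b S2"
proof -
  define pal where "pal v = (\<lambda>w. c {v, w}) ` (V - {v})" for v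
  have fin: "finite (pal v)" for v
    using assms(1) by (simp add: pal_def)
  have edge: "c {u, v} \<in> pal u" if "u \<in> V" "v \<in> V" "u \<noteq> v" for u v
    using that by (auto simp: pal_def)
  have "V \<noteq> {}"
    using assms by auto
  with assms(1) have "partitioned c V"
    using assms(4)
  proof (cases rule: palette_cases)
    case (star g)
    show ?thesis
    proof (rule star_partitioned[OF assms(1)])
      fix u v w
      assume *: "u \<in> V" "v \<in> V" "w \<in> V" "u \<noteq> v" "w \<noteq> v" "c {v, u} \<noteq> g" "c {v, w} \<noteq> g"
      show "c {v, u} = c {v, w}"
      proof (rule ccontr)
        assume ne: "c {v, u} \<noteq> c {v, w}"
        have sub: "{c {v, u}, c {v, w}} \<subseteq> pal v"
          using edge[of v u] edge[of v w] * by auto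
        \<comment> \<open>Two different colours rule out a palette of size at most one, so
          \<open>g\<close> would be a third colour at \<open>v\<close>.\<close>
        have "g \<in> pal v"
          using star[OF *(2)] card_mono[OF fin sub] ne by (auto simp: pal_def)
        then have "card {g, c {v, u}, c {v, w}} \<le> card (pal v)"
          using sub fin by (intro card_mono) auto
        also have "\<dots> \<le> 2"
          using assms(4) * by (simp add: two_local_def pal_def)
        finally show False
          using * ne by auto
      qed
    qed
  next
    case (triangle p q r)
    define A B D where "A = {v \<in> V. pal v = {p, q}}" and "B = {v \<in> V. pal v = {p, r}}"
      and "D = {v \<in> V. pal v = {q, r}}"
    note tri = triangle[folded pal_def]
    \<comment> \<open>The colour of an edge lies in the palettes of both ends, and the palettes of
      two different classes share exactly one colour.\<close>
    have col: "c {u, w} \<in> pal u" "c {u, w} \<in> pal w" if "u \<in> V" "w \<in> V" "u \<noteq> w" for u w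
      using edge[of u w] edge[of w u] that by (auto simp: insert_commute)
    have ne: "{p, q} \<noteq> {p, r}" "{p, q} \<noteq> {q, r}" "{p, r} \<noteq> {q, r}"
      using tri(1-3) by (auto simp: doubleton_eq_iff)
    have "A \<union> B \<union> D = V"
      using tri(4) by (auto simp: A_def B_def D_def)
    moreover have "triangle c A B D p q r"
      unfolding triangle_def
    proof (intro conjI ballI impI)
      show "finite A" "finite B" "finite D"
        using assms(1) by (auto simp: A_def B_def D_def)
      show "A \<noteq> {}" "B \<noteq> {}" "D \<noteq> {}"
        using tri(5) by (auto simp: A_def B_def D_def)
      show "A \<inter> B = {}" "A \<inter> D = {}" "B \<inter> D = {}"
        using ne by (auto simp: A_def B_def D_def)
      show "p \<noteq> q" "p \<noteq> r" "q \<noteq> r"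
        by (fact tri)+
    next
      fix u w
      assume "u \<in> A" "w \<in> B"
      then show "c {u, w} = p"
        using col[of u w] ne tri(1-3) by (cases "u = w") (auto simp: A_def B_def)
    next
      fix u w
      assume "u \<in> A" "w \<in> D"
      then show "c {u, w} = q"
        using col[of u w] ne tri(1-3) by (cases "u = w") (auto simp: A_def D_def)
    next
      fix u w
      assume "u \<in> B" "w \<in> D"
      then show "c {u, w} = r"
        using col[of u w] ne tri(1-3) by (cases "u = w") (auto simp: B_def D_def)
    qed (use col in \<open>auto simp: A_def B_def D_def\<close>)
    ultimately show ?thesis
      using triangle_partitioned by metis
  qed
  then show ?thesis
    unfolding partitioned_def using spans_cycle_imp_mono_cycle by metis
qed

end
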